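(* Let $p\in\left(\frac12,1\right)$. There exists a random cookie environment $\omega^*=(\omega^*(z,i))_{z\in\mathbb{Z},\,i\in\mathbb{N}}$ with jump parameter $p$ whose law is ergodic (with respect to the spatial shifts of $\mathbb{Z}$), such that the number $M_z$ of cookies at $z$ satisfies $E[M_z]=\infty$ for every $z\in\mathbb{Z}$, and such that the excited random walk $(Y_n)_{n\ge 0}$ started at $0$ in the environment $\omega^*$ has zero speed almost surely, i.e. for almost every realization $\omega$ of $\omega^*$, $$\lim_{n\to\infty}\frac{Y_n}{n}=0\qquad P_{0,\omega}\text{-almost surely}.$$
   Context: Here $\mathbb{N}=\{1,2,\dots\}$. An environment is an element $\omega=(\omega(z,i))_{z\in\mathbb{Z},i\in\mathbb{N}}$ of $\Omega=[0,1]^{\mathbb{Z}\times\mathbb{N}}$. For $\omega\in\Omega$ and $y_0\in\mathbb{Z}$, the excited random walk (ERW) $(Y_n)_{n\ge0}$ starting from $y_0$ in the environment $\omega$ is the $\mathbb{Z}$-valued process whose law $P_{y_0,\omega}$ satisfies $P_{y_0,\omega}[Y_0=y_0]=1$, $$P_{y_0,\omega}[Y_{n+1}=Y_n+1\mid (Y_i)_{0\le i\le n}]=\omega(Y_n,\#\{i\le n: Y_i=Y_n\}),$$ $$P_{y_0,\omega}[Y_{n+1}=Y_n-1\mid (Y_i)_{0\le i\le n}]=1-\omega(Y_n,\#\{i\le n: Y_i=Y_n\}).$$ Thus $\omega(z,i)$ is the probability of jumping from $z$ to $z+1$ at the $i$-th visit to $z$. A random cookie environment with jump parameter $p$ is an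 $\Omega$-valued random variable for which there are random numbers $M_z\in\{0,1,2,\dots\}\cup\{\infty\}$, $z\in\mathbb{Z}$ (the number of cookies at $z$), with $\omega(z,i)=p$ if $i\le M_z$ and $\omega(z,i)=\frac12$ if $i>M_z$. The law of a random environment is called ergodic if it is invariant under the spatial shifts $(\omega(z,i))_{z,i}\mapsto(\omega(z+1,i))_{z,i}$ of $\Omega$ and every shift-invariant event has probability $0$ or $1$. *)

theory Defs
  imports "HOL-Probability.Probability"
begin

section \<open>Random environments on the integers\<close>

text \<open>An environment is a function on pairs \<open>(z, i)\<close>, where \<open>i \<ge> 1\<close> numbers the visits to \<open>z\<close>.
  Elements of the product space are extensional, so \<open>\<omega> (z, 0)\<close> is a dummy value that is
  never used.\<close>

type_synonym env = "int \<times> nat \<Rightarrow> real"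

definition env_space :: "env measure" where
  "env_space = (\<Pi>\<^sub>M zi \<in> UNIV \<times> {1..}. restrict_space borel {0..1})"

definition env_shift :: "env \<Rightarrow> env" where
  "env_shift \<omega> = (\<lambda>(z, i). \<omega> (z + 1, i))"

definition ergodic_law :: "env measure \<Rightarrow> bool" where
  "ergodic_law L \<longleftrightarrow>
     prob_space L \<and> sets L = sets env_space \<and>
     distr L env_space env_shift = L \<and>
     (\<forall>A \<in> sets env_space. env_shift -` A \<inter> space env_space = A \<longrightarrow>
        measure L A = 0 \<or> measure L A = 1)"

text \<open>\<open>W\<close> is the random environment and \<open>M z\<close> the (possibly infinite) random number of cookies
  at \<open>z\<close>, both defined on the probability space \<open>Q\<close>.\<close>

definition random_cookie_env ::
    "real \<Rightarrow> 'a measure \<Rightarrow> ('a \<Rightarrow> env) \<Rightarrow> (int \<Rightarrow> 'a \<Rightarrow> enat) \<Rightarrow> bool" where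
  "random_cookie_env p Q W M \<longleftrightarrow>
     prob_space Q \<and> W \<in> measurable Q env_space \<and>
     (\<forall>z. M z \<in> measurable Q (count_space UNIV)) \<and>
     (\<forall>x \<in> space Q. \<forall>z. \<forall>i\<ge>1. W x (z, i) = (if enat i \<le> M z x then p else 1 / 2))"

section \<open>Excited random walk\<close>

definition path_space :: "(nat \<Rightarrow> int) measure" where
  "path_space = (\<Pi>\<^sub>M n \<in> UNIV. count_space UNIV)"

text \<open>The sigma-algebra generated by the coordinates \<open>Y 0, \<dots>, Y n\<close>.\<close>

definition history :: "nat \<Rightarrow> (nat \<Rightarrow> int) measure" where
  "history n = vimage_algebra UNIV (\<lambda>Y. restrict Y {..n}) (\<Pi>\<^sub>M i \<in> {..n}. count_space UNIV)"

definition visits :: "(nat \<Rightarrow> int) \<Rightarrow> nat \<Rightarrow> nat" where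
  "visits Y n = card {i. i \<le> n \<and> Y i = Y n}"

text \<open>\<open>erw_law \<omega> y0 P\<close> says that \<open>P\<close> is the law, on path space, of the excited random walk in the
  environment \<open>\<omega>\<close> started at \<open>y0\<close>; the walk itself is the coordinate process.\<close>

definition erw_law :: "env \<Rightarrow> int \<Rightarrow> (nat \<Rightarrow> int) measure \<Rightarrow> bool" where
  "erw_law \<omega> y0 P \<longleftrightarrow>
     prob_space P \<and> sets P = sets path_space \<and>
     measure P {Y. Y 0 = y0} = 1 \<and>
     (\<forall>n. AE Y in P.
        real_cond_exp P (history n) (indicator {Y. Y (Suc n) = Y n + 1}) Y
          = \<omega> (Y n, visits Y n)) \<and>
     (\<forall>n. AE Y in P.
        real_cond_exp P (history n) (indicator {Y. Y (Suc n) = Y n - 1}) Y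
          = 1 - \<omega> (Y n, visits Y n))"

section \<open>Existence of the excited random walk\<close>

text \<open>Statements about \<open>every P with erw_law \<omega> y0 P\<close> are not vacuous: a law exists in every
  environment, by the Ionescu--Tulcea theorem.\<close>

context
  fixes \<omega> :: env and y0 :: int
  assumes \<omega>: "\<omega> \<in> space env_space"
begin

private lemma \<omega>_bounds: "i \<ge> 1 \<Longrightarrow> 0 \<le> \<omega> (z, i) \<and> \<omega> (z, i) \<le> 1"
proof -
  assume "i \<ge> 1"
  hence "(z, i) \<in> UNIV \<times> {1..}" by simp
  with \<omega> have "\<omega> (z, i) \<in> space (restrict_space borel {0..1::real})"
    unfolding env_space_def space_PiM by (rule PiE_mem)
  thus ?thesis by (simp add: space_restrict_space)
qed

private lemma visits_pos: "visits Y n \<ge> 1"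
proof -
  have "finite {i. i \<le> n \<and> Y i = Y n}" by (rule finite_subset[of _ "{..n}"]) auto
  moreover have "n \<in> {i. i \<le> n \<and> Y i = Y n}" by simp
  ultimately show ?thesis unfolding visits_def
    by (metis One_nat_def Suc_leI card_gt_0_iff empty_iff)
qed

private definition rate :: "nat \<Rightarrow> (nat \<Rightarrow> int) \<Rightarrow> real" where
  "rate n Y = \<omega> (Y n, visits Y n)"

private lemma rate_bounds: "0 \<le> rate n Y" "rate n Y \<le> 1"
  using \<omega>_bounds[OF visits_pos] unfolding rate_def by blast+

private lemma rate_cong: "(\<And>i. i \<le> n \<Longrightarrow> Y i = Z i) \<Longrightarrow> rate n Y = rate n Z"
proof -
  assume *: "\<And>i. i \<le> n \<Longrightarrow> Y i = Z i"
  hence "{i. i \<le> n \<and> Y i = Y n} = {i. i \<le> n \<and> Z i = Z n}" by auto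
  thus ?thesis using * unfolding rate_def visits_def by simp
qed

private definition kern :: "nat \<Rightarrow> (nat \<Rightarrow> int) \<Rightarrow> int measure" where
  "kern n Y = (case n of 0 \<Rightarrow> measure_pmf (return_pmf y0)
     | Suc m \<Rightarrow> measure_pmf (map_pmf (\<lambda>b. if b then Y m + 1 else Y m - 1)
                   (bernoulli_pmf (rate m Y))))"

private lemma space_words: "finite I \<Longrightarrow>
    (\<Pi>\<^sub>M i \<in> I. count_space (UNIV :: int set)) = count_space (I \<rightarrow>\<^sub>E UNIV)"
  using count_space_PiM_finite[of I "\<lambda>_. UNIV :: int set"] by (simp add: comp_def)

private lemma IT: "Ionescu_Tulcea kern (\<lambda>_. count_space UNIV)"
proof (rule Ionescu_Tulcea.intro)
  fix n :: nat
  show "kern n \<in> measurable (\<Pi>\<^sub>M i\<in>{0..<n}. count_space UNIV) (subprob_algebra (count_space UNIV))"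
    unfolding space_words[OF finite_atLeastLessThan]
    by (auto simp: kern_def space_subprob_algebra measure_pmf.subprob_space_axioms split: nat.splits)
next
  fix n :: nat and x :: "nat \<Rightarrow> int"
  show "prob_space (kern n x)"
    by (auto simp: kern_def measure_pmf.prob_space_axioms split: nat.splits)
qed

interpretation IT: Ionescu_Tulcea kern "\<lambda>_. count_space UNIV" by (rule IT)

private abbreviation "P \<equiv> IT.PF.lim"

private lemma sets_P: "sets P = sets path_space"
  by (simp add: path_space_def)

private lemma space_paths: "space (\<Pi>\<^sub>M n \<in> (UNIV :: nat set). count_space (UNIV :: int set)) = UNIV"
  by (simp add: space_PiM)

private lemma space_P: "space P = UNIV"
  by (simp add: space_paths)

private lemma restrict_meas: "(\<lambda>Y. restrict Y J) \<in> measurable P (\<Pi>\<^sub>M i\<in>J. count_space UNIV)"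
  unfolding measurable_cong_sets[OF IT.PF.sets_lim refl]
  by (rule measurable_restrict_subset) simp

private lemma CI_eq: "IT.CI {0..<m} = IT.C 0 m (\<lambda>_. undefined)"
proof -
  have "IT.up_to {0..<m} = m"
  proof (rule antisym)
    show "IT.up_to {0..<m} \<le> m" by (simp add: IT.up_to_iff_Ico)
    show "m \<le> IT.up_to {0..<m}" using IT.up_to[of "{0..<m}"] by (cases m) auto
  qed
  moreover have "prob_space (IT.C 0 m (\<lambda>_. undefined))" by (rule IT.prob_space_C) simp
  ultimately show ?thesis unfolding IT.CI_def
    using IT.distr_C[of m m "\<lambda>_. undefined" 0] by simp
qed

private lemma step:
  fixes f :: "(nat \<Rightarrow> int) \<Rightarrow> ennreal"
  shows "(\<integral>\<^sup>+Y. f (restrict Y {0..<Suc m}) \<partial>P) =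
    (\<integral>\<^sup>+Y. (\<integral>\<^sup>+k. f ((restrict Y {0..<m})(m := k)) \<partial>kern m (restrict Y {0..<m})) \<partial>P)"
proof -
  let ?W = "\<lambda>m. \<Pi>\<^sub>M i\<in>{0..<m}. count_space (UNIV :: int set)"
  have meas: "g \<in> borel_measurable (?W m)" for g :: "(nat \<Rightarrow> int) \<Rightarrow> ennreal" and m
    unfolding space_words[OF finite_atLeastLessThan] by simp
  have *: "(\<integral>\<^sup>+Y. g (restrict Y {0..<m}) \<partial>P) = (\<integral>\<^sup>+Y. g Y \<partial>IT.C 0 m (\<lambda>_. undefined))"
    for g :: "(nat \<Rightarrow> int) \<Rightarrow> ennreal" and m
    unfolding CI_eq[symmetric] IT.distr_lim[OF finite_atLeastLessThan, symmetric]
    by (rule nn_integral_distr[OF restrict_meas, symmetric]) (simp add: meas)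
  have "(\<integral>\<^sup>+Y. f (restrict Y {0..<Suc m}) \<partial>P) = (\<integral>\<^sup>+Y. f Y \<partial>IT.C 0 (Suc m) (\<lambda>_. undefined))"
    by (rule *)
  also have "\<dots> = (\<integral>\<^sup>+Y. (\<integral>\<^sup>+Z. f Z \<partial>IT.eP m Y) \<partial>IT.C 0 m (\<lambda>_. undefined))"
    using IT.measurable_eP[of m] meas[of f "Suc m"]
    by (simp add: nn_integral_bind[where B="?W (Suc m)"] measurable_cong_sets[OF IT.sets_C refl])
  also have "\<dots> = (\<integral>\<^sup>+Y. (\<integral>\<^sup>+k. f (Y(m := k)) \<partial>kern m Y) \<partial>IT.C 0 m (\<lambda>_. undefined))"
    by (intro nn_integral_cong IT.nn_integral_eP meas) (simp add: IT.space_C)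
  also have "\<dots> = (\<integral>\<^sup>+Y. (\<integral>\<^sup>+k. f ((restrict Y {0..<m})(m := k)) \<partial>kern m (restrict Y {0..<m})) \<partial>P)"
    by (rule *[symmetric])
  finally show ?thesis .
qed

private lemma prob_P: "prob_space P"
proof (rule prob_space_distrD[OF restrict_meas])
  show "prob_space (distr P (\<Pi>\<^sub>M i\<in>{0..<0}. count_space UNIV) (\<lambda>Y. restrict Y {0..<0}))"
    unfolding IT.distr_lim[OF finite_atLeastLessThan] CI_eq by (rule IT.prob_space_C) simp
qed

private lemma coord_meas: "(\<lambda>Y. Y i) \<in> measurable P (count_space UNIV)"
  unfolding measurable_cong_sets[OF IT.PF.sets_lim refl]
  by (rule measurable_component_singleton) simp

private lemma start: "measure P {Y. Y 0 = y0} = 1"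
proof -
  interpret prob_space P by (rule prob_P)
  have [measurable]: "(\<lambda>Y. Y 0) \<in> measurable P (count_space UNIV)" by (rule coord_meas)
  have "{Y \<in> space P. Y 0 = y0} \<in> sets P" by measurable
  hence S: "{Y. Y 0 = y0} \<in> sets P" by (simp only: space_P UNIV_I simp_thms)
  have "emeasure P {Y. Y 0 = y0} = (\<integral>\<^sup>+Y. indicator {Y. Y 0 = y0} (restrict Y {0..<Suc 0}) \<partial>P)"
    unfolding nn_integral_indicator[OF S, symmetric]
    by (intro nn_integral_cong) (simp add: indicator_def)
  also have "\<dots> = 1"
    unfolding step using emeasure_space_1 by (simp add: kern_def)
  finally show ?thesis by (simp add: measure_def)
qed

private lemma sets_historyE:
  assumes "A \<in> sets (history n)"
  obtains B where "A = {Y. restrict Y {0..<Suc n} \<in> B}"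
proof -
  have "{..n} = {0..<Suc n}" by auto
  with assms that show thesis
    unfolding history_def by (subst (asm) sets_vimage_algebra2) (auto simp: space_PiM vimage_def)
qed

private lemma subalg: "subalgebra P (history n)"
proof -
  have "sets (history n) \<subseteq> sets P"
    unfolding history_def
    by (rule sets_image_in_sets) (use restrict_meas in \<open>auto simp: space_paths\<close>)
  thus ?thesis by (simp add: subalgebra_def space_paths history_def)
qed

private lemma rate_meas: "rate n \<in> borel_measurable (history n)"
proof -
  have "rate n \<in> borel_measurable (\<Pi>\<^sub>M i \<in> {..n}. count_space UNIV)"
    unfolding space_words[OF finite_atMost] by simp
  moreover have "(\<lambda>Y. restrict Y {..n}) \<in> measurable (history n) (\<Pi>\<^sub>M i \<in> {..n}. count_space UNIV)"
    unfolding history_def by (rule measurable_vimage_algebra1) (auto simp: space_PiM)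
  ultimately have "(\<lambda>Y. rate n (restrict Y {..n})) \<in> borel_measurable (history n)"
    by (rule measurable_compose[rotated])
  moreover have "rate n (restrict Y {..n}) = rate n Y" for Y by (rule rate_cong) simp
  ultimately show ?thesis by simp
qed

private lemma cond:
  assumes d: "(d = 1 \<and> q = rate n) \<or> (d = - 1 \<and> q = (\<lambda>Y. 1 - rate n Y))"
  shows "AE Y in P. real_cond_exp P (history n) (indicator {Y. Y (Suc n) = Y n + d}) Y = q Y"
proof -
  interpret prob_space P by (rule prob_P)
  interpret finite_measure_subalgebra P "history n"
    by unfold_locales (rule subalg)
  have q_meas [measurable]: "q \<in> borel_measurable (history n)"
    using d rate_meas by auto
  have q_meas' [measurable]: "q \<in> borel_measurable P"
    by (rule measurable_from_subalg[OF subalg q_meas])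
  have q_bounds: "0 \<le> q Y" "q Y \<le> 1" for Y using d rate_bounds[of n Y] by auto
  let ?U = "{Y. Y (Suc n) = Y n + d} :: (nat \<Rightarrow> int) set"
  have [measurable]: "(\<lambda>Y. Y (Suc n)) \<in> measurable P (count_space UNIV)"
    "(\<lambda>Y. Y n) \<in> measurable P (count_space UNIV)" by (rule coord_meas)+
  have "{Y \<in> space P. Y (Suc n) = Y n + d} \<in> sets P" by measurable
  hence U [measurable]: "?U \<in> sets P" by (simp add: space_paths)
  have ker: "emeasure (kern (Suc n) Y) {k. k = Y n + d} = ennreal (q Y)" for Y
  proof -
    have "emeasure (kern (Suc n) Y) {k. k = Y n + d} =
        ennreal (pmf (map_pmf (\<lambda>b. if b then Y n + 1 else Y n - 1)
                   (bernoulli_pmf (rate n Y))) (Y n + d))"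
      by (simp add: kern_def emeasure_pmf_single)
    also have "pmf (map_pmf (\<lambda>b. if b then Y n + 1 else Y n - 1)
                   (bernoulli_pmf (rate n Y))) (Y n + d) = q Y"
      using d
    proof
      assume *: "d = 1 \<and> q = rate n"
      have "(\<lambda>b. if b then Y n + 1 else Y n - 1) -` {Y n + 1} = {True}"
        by (auto split: if_splits)
      thus ?thesis using * rate_bounds[of n Y] by (simp add: pmf_map measure_pmf_single)
    next
      assume *: "d = - 1 \<and> q = (\<lambda>Y. 1 - rate n Y)"
      have "(\<lambda>b. if b then Y n + 1 else Y n - 1) -` {Y n + - 1} = {False}"
        by (auto split: if_splits)
      thus ?thesis using * rate_bounds[of n Y] by (simp add: pmf_map measure_pmf_single)
    qed
    finally show ?thesis .
  qed
  show ?thesis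
  proof (rule real_cond_exp_charact)
    fix A assume A: "A \<in> sets (history n)"
    hence [measurable]: "A \<in> sets P" using subalg by (auto simp: subalgebra_def)
    from A obtain B where B: "A = {Y. restrict Y {0..<Suc n} \<in> B}" by (rule sets_historyE)
    have "(\<integral>\<^sup>+Y. ennreal (indicator A Y * indicator ?U Y) \<partial>P) =
        (\<integral>\<^sup>+Y. indicator A (restrict Y {0..<Suc (Suc n)}) *
               indicator ?U (restrict Y {0..<Suc (Suc n)}) \<partial>P)"
    proof (intro nn_integral_cong)
      fix Y :: "nat \<Rightarrow> int"
      have "{0..<Suc (Suc n)} \<inter> {0..<Suc n} = {0..<Suc n}" by auto
      hence "restrict Y {0..<Suc (Suc n)} \<in> A \<longleftrightarrow> Y \<in> A"
        unfolding B mem_Collect_eq restrict_restrict by simp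
      thus "ennreal (indicator A Y * indicator ?U Y) =
         indicator A (restrict Y {0..<Suc (Suc n)}) * indicator ?U (restrict Y {0..<Suc (Suc n)})"
        by (auto split: split_indicator)
    qed
    also have "\<dots> = (\<integral>\<^sup>+Y. ennreal (indicator A Y * q Y) \<partial>P)"
      unfolding step[where m = "Suc n" and f = "\<lambda>Z. indicator A Z * indicator ?U Z"]
    proof (intro nn_integral_cong)
      fix Y :: "nat \<Rightarrow> int"
      let ?Y = "restrict Y {0..<Suc n}"
      have up: "?Y(Suc n := k) \<in> A \<longleftrightarrow> Y \<in> A" for k
      proof -
        have "restrict (?Y(Suc n := k)) {0..<Suc n} = ?Y" by (auto simp: fun_eq_iff)
        thus ?thesis by (simp only: B mem_Collect_eq)
      qed
      have 1: "indicator A (?Y(Suc n := k)) = (indicator A Y :: ennreal)" for k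
        by (simp only: indicator_def up)
      have 2: "indicator ?U (?Y(Suc n := k)) = (indicator {k. k = ?Y n + d} k :: ennreal)" for k
        by (simp add: indicator_def)
      have "(\<integral>\<^sup>+k. indicator A (?Y(Suc n := k)) * indicator ?U (?Y(Suc n := k)) \<partial>kern (Suc n) ?Y)
          = (\<integral>\<^sup>+k. indicator A Y * indicator {k. k = ?Y n + d} k \<partial>kern (Suc n) ?Y)"
        by (simp only: 1 2)
      also have "\<dots> = indicator A Y * ennreal (q ?Y)"
        by (subst nn_integral_cmult_indicator) (simp_all only: ker, simp add: kern_def)
      also have "q ?Y = q Y"
        using d rate_cong[of n ?Y Y] by auto
      also have "indicator A Y * ennreal (q Y) = ennreal (indicator A Y * q Y)"
        by (auto split: split_indicator)
      finally show "(\<integral>\<^sup>+k. indicator A (?Y(Suc n := k)) * indicator ?U (?Y(Suc n := k))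
          \<partial>kern (Suc n) ?Y) = ennreal (indicator A Y * q Y)" .
    qed
    finally have eq: "(\<integral>\<^sup>+Y. ennreal (indicator A Y * indicator ?U Y) \<partial>P)
        = (\<integral>\<^sup>+Y. ennreal (indicator A Y * q Y) \<partial>P)" .
    have "(\<integral>Y. indicator A Y * indicator ?U Y \<partial>P) = (\<integral>Y. indicator A Y * q Y \<partial>P)"
      using eq by (subst (1 2) integral_eq_nn_integral) (auto simp: q_bounds)
    thus "(LINT Y:A|P. indicator ?U Y) = (LINT Y:A|P. q Y)"
      by (simp add: set_lebesgue_integral_def)
  next
    show "integrable P (indicator ?U :: _ \<Rightarrow> real)"
      by (rule integrable_const_bound[where B=1]) auto
    show "integrable P q"
      by (rule integrable_const_bound[where B=1]) (use q_bounds in auto)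
  qed (rule q_meas)
qed

lemma erw_law_exists: "\<exists>P. erw_law \<omega> y0 P"
proof -
  have "erw_law \<omega> y0 P"
    unfolding erw_law_def
    using prob_P sets_P start cond[of 1] cond[of "- 1"] by (simp add: rate_def)
  thus ?thesis ..
qed

end

end

theory Submission
  imports Defs
begin

text \<open>
  The environment. Attach to every site \<open>a\<close> and level \<open>n\<close> an independent uniform variable, and say
  that \<open>a\<close> fires at level \<open>n\<close> if this variable is at most \<open>3^-n / 6\<close>; then \<open>a\<close> removes all cookies
  from the \<open>2^n\<close> sites \<open>a, \<dots>, a + 2^n - 1\<close>. A site that is covered by no such interval gets infinitely
  many cookies. By the union bound a site is covered with probability at most
  \<open>(\<Sum>n. 2^n * 3^-n / 6) = 1 / 2\<close>, so that \<open>E[M z] = \<infinity>\<close>; and the law is ergodic since it is an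
  equivariant image of a Bernoulli shift, which is mixing.

  Zero speed. Intervals without cookies act like simple random walk, so an interval of length
  \<open>B = 2^n\<close> costs time of order \<open>B\<^sup>2\<close>, while the frequency \<open>q = 3^-n / 6\<close> of such intervals satisfies
  \<open>q * B\<^sup>2 \<rightarrow> \<infinity>\<close>: the time needed per unit of length is infinite. To make this quantitative, divide the
  half-line into blocks of length \<open>2 * B\<close> and call a block good if some site in its first half fires at
  level \<open>n\<close>. Let \<open>h\<close> be the nondecreasing function that is constant except on one interval of length
  \<open>B\<close> in each good block, where it doubles along a parabola. Whatever the environment does outside these
  intervals, one step of the walk multiplies the conditional expectation of \<open>h\<close> by at most
  \<open>1 + 1 / B\<^sup>2\<close> (lemma \<open>climb_step\<close>). By Markov's inequality the probability that the walk is beyond the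
  \<open>N\<close>-th block at time \<open>m\<close> is at most \<open>(1 + 1 / B\<^sup>2)^m\<close> times \<open>1 / 2\<close> to the number of good blocks among
  the first \<open>N\<close> (lemma \<open>erw_upper_tail\<close>). Blocks are independent and good with probability at least
  \<open>B * q / 2\<close>, so the average of this bound over the environment is at most
  \<open>exp (m / B\<^sup>2 - N * B * q / 4)\<close>. With \<open>N\<close> about \<open>m / (2 * B * k)\<close> this is summable in \<open>m\<close> as soon as
  \<open>q * B\<^sup>2 > 8 * k\<close> (lemma \<open>AE_summable_good_block\<close>), so that almost surely \<open>Y m < m / k\<close> eventually, by
  the Borel--Cantelli lemma.
  The drift is never negative, hence the bound \<open>Y m > - m / k\<close> follows, in every such environment, from
  the reflection of \<open>h\<close> with all blocks declared good (lemma \<open>erw_lower_tail\<close>).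
\<close>

section \<open>Bernoulli shifts are ergodic\<close>

text \<open>Every event is approximated in probability by sets of a generating algebra: the events that can be
  approximated form a sigma-algebra.\<close>

lemma (in prob_space) approx_by_algebra:
  assumes G: "algebra (space M) G" and gen: "sets M = sigma_sets (space M) G"
    and A: "A \<in> sets M" and "e > 0"
  shows "\<exists>C\<in>G. prob ((A - C) \<union> (C - A)) < e"
proof -
  interpret G: algebra "space M" G by (rule G)
  have GM: "G \<subseteq> sets M" unfolding gen by (auto intro: sigma_sets.Basic)
  from A have "A \<in> sigma_sets (space M) G" by (simp add: gen)
  then show ?thesis using \<open>e > 0\<close>
  proof (induction arbitrary: e)
    case (Basic a)
    then show ?case by (intro bexI[of _ a]) auto
  next
    case Empty
    then show ?case by (intro bexI[of _ "{}"]) auto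
  next
    case (Compl a)
    then obtain C where C: "C \<in> G" "prob ((a - C) \<union> (C - a)) < e" by blast
    have "a \<subseteq> space M" using Compl.hyps sets.sets_into_space gen by blast
    then have "((space M - a) - (space M - C)) \<union> ((space M - C) - (space M - a)) = (a - C) \<union> (C - a)"
      using sets.sets_into_space[of C M] C(1) GM by blast
    with C show ?case by (intro bexI[of _ "space M - C"]) auto
  next
    case (Union a)
    let ?U = "\<Union>i. a i" and ?V = "\<lambda>n. \<Union>i<n. a i"
    have am: "a i \<in> sets M" for i using Union.hyps gen by simp
    have Vm: "?V n \<in> sets M" for n using am by auto
    have Um: "?U \<in> sets M" using am by auto
    have "incseq ?V" by (auto simp: incseq_def) (meson lessThan_iff order_less_le_trans)
    moreover have "(\<Union>n. ?V n) = ?U" by auto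
    ultimately have "(\<lambda>n. prob (?V n)) \<longlonglongrightarrow> prob ?U"
      using finite_Lim_measure_incseq[of ?V] Vm by (metis image_subset_iff)
    then have "eventually (\<lambda>n. prob ?U - e/2 < prob (?V n)) sequentially"
      using \<open>e > 0\<close> by (intro order_tendstoD) auto
    then obtain n where n: "prob ?U - e/2 < prob (?V n)"
      by (auto simp: eventually_sequentially)
    have "\<forall>i. \<exists>C\<in>G. prob ((a i - C) \<union> (C - a i)) < e / (2 * (real n + 1))"
      using Union.IH \<open>e > 0\<close> by simp
    then obtain C where C: "\<And>i. C i \<in> G"
      "\<And>i. prob ((a i - C i) \<union> (C i - a i)) < e / (2 * (real n + 1))" by metis
    have Cm: "C i \<in> sets M" for i using C(1) GM by auto
    let ?D = "\<Union>i<n. C i" and ?E = "\<lambda>i. (a i - C i) \<union> (C i - a i)"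
    have Dm: "?D \<in> sets M" using Cm by auto
    have Em: "?E i \<in> sets M" for i using am Cm by auto
    have "prob ((?U - ?D) \<union> (?D - ?U)) \<le> prob ((?U - ?V n) \<union> (\<Union>i<n. ?E i))"
      using Um Vm Em by (intro finite_measure_mono) auto
    also have "\<dots> \<le> prob (?U - ?V n) + prob (\<Union>i<n. ?E i)"
      using Um Vm Em by (intro measure_Un_le) auto
    also have "prob (?U - ?V n) = prob ?U - prob (?V n)"
      by (intro finite_measure_Diff Um Vm) auto
    also have "prob (\<Union>i<n. ?E i) \<le> (\<Sum>i<n. prob (?E i))"
      using Em by (intro finite_measure_subadditive_finite) auto
    also have "\<dots> \<le> (\<Sum>i<n. e / (2 * (real n + 1)))"
      using C(2) by (intro sum_mono less_imp_le)
    also have "\<dots> = e/2 * (real n / (real n + 1))" by simp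
    also have "\<dots> \<le> e/2 * 1" using \<open>e > 0\<close> by (intro mult_left_mono) auto
    finally have "prob ((?U - ?D) \<union> (?D - ?U)) < e" using n by simp
    moreover have "?D \<in> G" using C(1) by auto
    ultimately show ?case by blast
  qed
qed

text \<open>An invariant event \<open>A\<close> is close to some \<open>C\<close> in the algebra, and both \<open>A\<close> and \<open>A \<inter> T^-k A = A\<close> are
  then close to \<open>C\<close> and to \<open>C \<inter> T^-k C\<close>. Hence \<open>P(A)\<close> is close to \<open>P(A)\<^sup>2\<close>.\<close>

lemma (in prob_space) zero_one_law_mixing:
  assumes G: "algebra (space M) G" and gen: "sets M = sigma_sets (space M) G"
    and T: "T \<in> measurable M M" and inv: "distr M M T = M"
    and mix: "\<And>C. C \<in> G \<Longrightarrow> \<exists>k. 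
        prob (C \<inter> ((T ^^ k) -` C \<inter> space M)) = prob C * prob ((T ^^ k) -` C \<inter> space M)"
    and A: "A \<in> sets M" and TA: "T -` A \<inter> space M = A"
  shows "prob A = 0 \<or> prob A = 1"
proof -
  have GM: "G \<subseteq> sets M" unfolding gen by (auto intro: sigma_sets.Basic)
  have Tk: "T ^^ k \<in> measurable M M" for k
    by (induction k) (use T in \<open>auto intro: measurable_comp\<close>)
  have dk: "distr M M (T ^^ k) = M" for k
  proof (induction k)
    case 0
    then show ?case using distr_id[of M] by (simp add: id_def)
  next
    case (Suc k)
    have "distr M M (T ^^ Suc k) = distr (distr M M (T ^^ k)) M T"
      by (simp add: distr_distr[OF T Tk])
    then show ?case by (simp add: Suc inv comp_def)
  qed
  have pk: "prob ((T ^^ k) -` B \<inter> space M) = prob B" if "B \<in> sets M" for B k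
    using measure_distr[OF Tk that, of k] dk by simp
  have Ak: "(T ^^ k) -` A \<inter> space M = A" for k
  proof (induction k)
    case 0
    then show ?case using sets.sets_into_space[OF A] by auto
  next
    case (Suc k)
    have "(T ^^ Suc k) -` A \<inter> space M = (T ^^ k) -` (T -` A \<inter> space M) \<inter> space M"
      using measurable_space[OF Tk] by auto
    then show ?case by (simp only: TA Suc.IH)
  qed
  have bound: "\<bar>prob A - (prob A)\<^sup>2\<bar> \<le> e" if "e > 0" for e
  proof -
    obtain C where C: "C \<in> G" and Ce: "prob ((A - C) \<union> (C - A)) < e / 5"
      using approx_by_algebra[OF G gen A, of "e/5"] \<open>e > 0\<close> by auto
    have Cm: "C \<in> sets M" using C GM by auto
    obtain k where k: "prob (C \<inter> ((T ^^ k) -` C \<inter> space M)) = (prob C)\<^sup>2"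
      using mix[OF C] pk[OF Cm] by (auto simp: power2_eq_square)
    let ?S = "(A - C) \<union> (C - A)"
    let ?C' = "(T ^^ k) -` C \<inter> space M"
    let ?S' = "(T ^^ k) -` ?S \<inter> space M"
    have Sm: "?S \<in> sets M" using A Cm by auto
    have C'm: "?C' \<in> sets M" by (rule measurable_sets[OF Tk Cm])
    have S'm: "?S' \<in> sets M" by (rule measurable_sets[OF Tk Sm])
    have S'p: "prob ?S' = prob ?S" by (rule pk[OF Sm])
    have AC: "\<bar>prob A - prob C\<bar> \<le> prob ?S"
    proof -
      have "prob A \<le> prob (C \<union> ?S)" using A Cm Sm by (intro finite_measure_mono) auto
      also have "\<dots> \<le> prob C + prob ?S" using Cm Sm by (intro measure_Un_le)
      finally have 1: "prob A \<le> prob C + prob ?S" .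
      have "prob C \<le> prob (A \<union> ?S)" using A Cm Sm by (intro finite_measure_mono) auto
      also have "\<dots> \<le> prob A + prob ?S" using A Sm by (intro measure_Un_le)
      finally show ?thesis using 1 by linarith
    qed
    have sub: "A \<subseteq> (C \<inter> ?C') \<union> (?S \<union> ?S')" "C \<inter> ?C' \<subseteq> A \<union> ?S"
      using Ak[of k] by blast+
    have "prob A \<le> prob ((C \<inter> ?C') \<union> (?S \<union> ?S'))"
      using A Cm Sm C'm S'm sub by (intro finite_measure_mono) auto
    also have "\<dots> \<le> prob (C \<inter> ?C') + prob (?S \<union> ?S')"
      using Cm Sm C'm S'm by (intro measure_Un_le) auto
    also have "prob (?S \<union> ?S') \<le> prob ?S + prob ?S'"
      using Sm S'm by (intro measure_Un_le)
    finally have 1: "prob A \<le> (prob C)\<^sup>2 + 2 * prob ?S" using S'p k by simp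
    have "prob (C \<inter> ?C') \<le> prob (A \<union> ?S)"
      using A Sm sub by (intro finite_measure_mono) auto
    also have "\<dots> \<le> prob A + prob ?S" using A Sm by (intro measure_Un_le)
    finally have 2: "(prob C)\<^sup>2 \<le> prob A + prob ?S" using k by simp
    have "\<bar>(prob A)\<^sup>2 - (prob C)\<^sup>2\<bar> = \<bar>prob A - prob C\<bar> * (prob A + prob C)"
      by (simp add: power2_eq_square square_diff_square_factored abs_mult mult.commute)
    also have "\<dots> \<le> prob ?S * 2"
    proof (rule mult_mono[OF AC])
      show "prob A + prob C \<le> 2" using prob_le_1[of A] prob_le_1[of C] by linarith
    qed auto
    finally show ?thesis using 1 2 Ce by linarith
  qed
  have "\<bar>prob A - (prob A)\<^sup>2\<bar> \<le> 0"
  proof (rule field_le_epsilon)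
    show "\<bar>prob A - (prob A)\<^sup>2\<bar> \<le> 0 + e" if "e > 0" for e using bound[OF that] by simp
  qed
  then have "prob A * (1 - prob A) = 0" by (simp add: power2_eq_square algebra_simps)
  then show ?thesis by simp
qed

lemma PiM_reindex_invariant:
  assumes N: "prob_space N" and \<sigma>: "inj_on \<sigma> I" "\<sigma> \<in> I \<rightarrow> I"
  shows "distr (\<Pi>\<^sub>M i\<in>I. N) (\<Pi>\<^sub>M i\<in>I. N) (\<lambda>x. \<lambda>i\<in>I. x (\<sigma> i)) = (\<Pi>\<^sub>M i\<in>I. N)"
  using distr_PiM_reindex[of I "\<lambda>_. N" \<sigma> I] assms by simp

lemma prob_space_indep_coordinates:
  assumes N: "prob_space N" and "I \<noteq> {}"
  shows "prob_space.indep_vars (\<Pi>\<^sub>M i\<in>I. N) (\<lambda>_. N) (\<lambda>i x. x i) I"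
proof -
  interpret P: prob_space "\<Pi>\<^sub>M i\<in>I. N" by (intro prob_space_PiM N)
  have "distr (\<Pi>\<^sub>M i\<in>I. N) (\<Pi>\<^sub>M i\<in>I. N) (\<lambda>x. \<lambda>i\<in>I. x i) = (\<Pi>\<^sub>M i\<in>I. N)"
    by (rule PiM_reindex_invariant[OF N, where \<sigma>="\<lambda>i. i"]) auto
  also have "\<dots> = (\<Pi>\<^sub>M i\<in>I. distr (\<Pi>\<^sub>M i\<in>I. N) N (\<lambda>x. x i))"
    by (intro PiM_cong refl distr_PiM_component[symmetric] N)
  finally show ?thesis
    by (subst P.indep_vars_iff_distr_eq_PiM'[OF \<open>I \<noteq> {}\<close>]) auto
qed

text \<open>The assumption \<open>wander\<close> says that every finite set of indices is moved off itself by some iterate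
  of the index map, so that a cylinder event and its preimage under that iterate depend on disjoint sets of
  coordinates.\<close>

lemma bernoulli_shift_zero_one:
  fixes N :: "'a measure" and I :: "'i set" and \<sigma> :: "'i \<Rightarrow> 'i"
  defines "L \<equiv> \<Pi>\<^sub>M i\<in>I. N" and "T \<equiv> \<lambda>x. \<lambda>i\<in>I. x (\<sigma> i)"
  assumes N: "prob_space N" and "I \<noteq> {}" and \<sigma>: "inj_on \<sigma> I" "\<sigma> \<in> I \<rightarrow> I"
    and wander: "\<And>J. finite J \<Longrightarrow> J \<subseteq> I \<Longrightarrow> \<exists>k. (\<sigma> ^^ k) ` J \<inter> J = {}"
    and A: "A \<in> sets L" "T -` A \<inter> space L = A"
  shows "measure L A = 0 \<or> measure L A = 1"
proof -
  interpret N: prob_space N by (rule N)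
  interpret PP: product_prob_space "\<lambda>_. N" I by unfold_locales
  interpret P: prob_space L unfolding L_def by (intro prob_space_PiM N)
  have T: "T \<in> measurable L L"
    unfolding T_def L_def using \<sigma>(2)
    by (intro measurable_restrict measurable_component_singleton) auto
  have \<sigma>k: "(\<sigma> ^^ k) i \<in> I" if "i \<in> I" for i k
    using that \<sigma>(2) by (induction k) auto
  have Tk: "(T ^^ k) x i = x ((\<sigma> ^^ k) i)" if "i \<in> I" for k x i
    using that
  proof (induction k arbitrary: i)
    case (Suc k)
    have "(T ^^ Suc k) x i = (T ^^ k) x (\<sigma> i)" using Suc.prems by (simp add: T_def)
    also have "\<dots> = x ((\<sigma> ^^ k) (\<sigma> i))" using Suc \<sigma>(2) by auto
    finally show ?case by (simp add: funpow_swap1)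
  qed simp
  show ?thesis
  proof (rule P.zero_one_law_mixing[OF _ _ T _ _ A])
    show "algebra (space L) PP.generator" unfolding L_def by (rule PP.algebra_generator)
    show "sets L = sigma_sets (space L) PP.generator"
      unfolding L_def by (rule PP.sets_PiM_generator)
    show "distr L L T = L"
      unfolding L_def T_def by (rule PiM_reindex_invariant[OF N \<sigma>])
    fix C assume "C \<in> PP.generator"
    then obtain J X where J: "finite J" "J \<subseteq> I" and X: "X \<in> sets (\<Pi>\<^sub>M i\<in>J. N)"
      and C: "C = prod_emb I (\<lambda>_. N) J X" by (auto elim: PP.generator.cases)
    obtain k where k: "(\<sigma> ^^ k) ` J \<inter> J = {}" using wander[OF J] by auto
    define K where "K = (\<sigma> ^^ k) ` J"
    have C': "C = (\<lambda>x. restrict x J) -` X \<inter> space L"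
      by (simp add: C prod_emb_def L_def space_PiM)
    define R :: "('i \<Rightarrow> 'a) \<Rightarrow> 'i \<Rightarrow> 'a" where "R = (\<lambda>y. \<lambda>j\<in>J. y ((\<sigma> ^^ k) j))"
    have R: "R \<in> measurable (\<Pi>\<^sub>M i\<in>K. N) (\<Pi>\<^sub>M i\<in>J. N)"
      unfolding R_def by (intro measurable_restrict measurable_component_singleton) (auto simp: K_def)
    have iv: "P.indep_vars (\<lambda>_. N) (\<lambda>i x. x i) I"
      unfolding L_def by (rule prob_space_indep_coordinates[OF N \<open>I \<noteq> {}\<close>])
    have "P.indep_var (\<Pi>\<^sub>M i\<in>J. N) (\<lambda>x. restrict x J) (\<Pi>\<^sub>M i\<in>K. N) (\<lambda>x. restrict x K)"
      using P.indep_var_restrict[OF iv, of J K] k J \<sigma>k by (auto simp: K_def)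
    then have "P.indep_var (\<Pi>\<^sub>M i\<in>J. N) (id \<circ> (\<lambda>x. restrict x J)) (\<Pi>\<^sub>M i\<in>J. N) (R \<circ> (\<lambda>x. restrict x K))"
      by (rule P.indep_var_compose) (use R in auto)
    from P.indep_varD[OF this X X]
    have "P.prob ((\<lambda>x. (restrict x J, R (restrict x K))) -` (X \<times> X) \<inter> space L) =
        P.prob C * P.prob ((\<lambda>x. R (restrict x K)) -` X \<inter> space L)"
      by (simp add: C' comp_def)
    also have "(\<lambda>x. R (restrict x K)) -` X \<inter> space L = (T ^^ k) -` C \<inter> space L"
    proof -
      have Tk_space: "(T ^^ k) x \<in> space L" if "x \<in> space L" for x
        using that measurable_space[OF T] by (induction k) auto
      have "R (restrict x K) = restrict ((T ^^ k) x) J" for x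
        using J by (auto simp: R_def K_def Tk fun_eq_iff restrict_def)
      then show ?thesis unfolding C' using Tk_space by auto
    qed
    also have "(\<lambda>x. (restrict x J, R (restrict x K))) -` (X \<times> X) \<inter> space L =
        C \<inter> ((\<lambda>x. R (restrict x K)) -` X \<inter> space L)"
      by (auto simp: C')
    also have "\<dots> = C \<inter> ((T ^^ k) -` C \<inter> space L)"
      by (simp only: \<open>(\<lambda>x. R (restrict x K)) -` X \<inter> space L = (T ^^ k) -` C \<inter> space L\<close>)
    finally show "\<exists>k. P.prob (C \<inter> ((T ^^ k) -` C \<inter> space L)) =
        P.prob C * P.prob ((T ^^ k) -` C \<inter> space L)" ..
  qed
qed

section \<open>A multiplicative Lyapunov function\<close>

text \<open>The function that is \<open>1\<close> up to \<open>a\<close>, is \<open>2\<close> from \<open>a + B\<close> on, and grows quadratically in between.\<close>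

definition ramp :: "nat \<Rightarrow> int \<Rightarrow> int \<Rightarrow> real" where
  "ramp B a z = 1 + (real_of_int (max 0 (min (z - a) (int B))) / real B)\<^sup>2"

lemma ramp_left: "z \<le> a \<Longrightarrow> ramp B a z = 1"
  by (simp add: ramp_def)

lemma ramp_right: "B > 0 \<Longrightarrow> a + int B \<le> z \<Longrightarrow> ramp B a z = 2"
  by (simp add: ramp_def)

lemma ramp_mid: "a \<le> z \<Longrightarrow> z \<le> a + int B \<Longrightarrow> ramp B a z = 1 + (real_of_int (z - a) / real B)\<^sup>2"
  by (simp add: ramp_def)

lemma ramp_ge_1: "1 \<le> ramp B a z"
  by (simp add: ramp_def)

lemma ramp_mono:
  assumes "y \<le> z" shows "ramp B a y \<le> ramp B a z"
  unfolding ramp_def using assms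
  by (intro add_left_mono power_mono divide_right_mono) auto

lemma ramp_le_2:
  assumes "B > 0" shows "ramp B a z \<le> 2"
  using ramp_mono[of z "max z (a + int B)" B a] ramp_right[OF assms, of a "max z (a + int B)"] by simp

text \<open>A nearest-neighbour step to the right with probability \<open>w\<close> increases the expectation of \<open>ramp\<close> at most
  by the factor \<open>1 + 1 / B\<^sup>2\<close>. Only strictly inside \<open>(a, a + B)\<close> does this need \<open>w = 1 / 2\<close>: at \<open>a\<close> even a
  sure step to the right gives just this factor.\<close>

lemma ramp_step:
  assumes B: "B > 0" and w: "1 / 2 \<le> w" "w \<le> 1"
    and mid: "a < z \<Longrightarrow> z < a + int B \<Longrightarrow> w = 1 / 2"
  shows "w * ramp B a (z + 1) + (1 - w) * ramp B a (z - 1) \<le> (1 + 1 / (real B)\<^sup>2) * ramp B a z"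
proof -
  have pos: "0 \<le> 1 / (real B)\<^sup>2" by simp
  consider "z < a" | "z = a" | "a < z" "z < a + int B" | "a + int B \<le> z" by linarith
  then show ?thesis
  proof cases
    case 1
    then show ?thesis using pos by (simp add: ramp_left)
  next
    case 2
    have "ramp B a (z + 1) = 1 + 1 / (real B)\<^sup>2"
      using 2 B by (simp add: ramp_mid power_divide)
    moreover have "w * (1 / (real B)\<^sup>2) \<le> 1 * (1 / (real B)\<^sup>2)"
      using w pos by (intro mult_right_mono)
    ultimately show ?thesis using 2 by (simp add: ramp_left algebra_simps)
  next
    case 3
    define t where "t = real_of_int (z - a)"
    define c where "c = 1 / (real B)\<^sup>2"
    have "ramp B a (z + 1) = 1 + (t + 1)\<^sup>2 * c"
      "ramp B a (z - 1) = 1 + (t - 1)\<^sup>2 * c"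
      "ramp B a z = 1 + t\<^sup>2 * c"
      using 3 by (simp_all add: ramp_mid t_def c_def power_divide algebra_simps)
    then have "w * ramp B a (z + 1) + (1 - w) * ramp B a (z - 1) = ramp B a z + c"
      by (simp add: mid[OF 3] field_simps power2_eq_square)
    then have "w * ramp B a (z + 1) + (1 - w) * ramp B a (z - 1) = ramp B a z + 1 / (real B)\<^sup>2"
      by (simp only: c_def)
    also have "\<dots> \<le> ramp B a z + 1 / (real B)\<^sup>2 * ramp B a z"
      using mult_left_mono[OF ramp_ge_1 pos, of B a z] by simp
    finally show ?thesis by (simp add: algebra_simps)
  next
    case 4
    have "(1 - w) * ramp B a (z - 1) \<le> (1 - w) * 2"
      using w ramp_le_2[OF B] by (intro mult_left_mono) auto
    then have "w * ramp B a (z + 1) + (1 - w) * ramp B a (z - 1) \<le> 2"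
      using 4 by (simp add: ramp_right[OF B])
    also have "\<dots> \<le> (1 + 1 / (real B)\<^sup>2) * ramp B a z"
      using 4 pos by (simp add: ramp_right[OF B])
    finally show ?thesis .
  qed
qed

text \<open>The product of the ramps of the good blocks among the first \<open>N\<close>. Block \<open>j\<close> is the interval from
  \<open>2 * B * j\<close> to \<open>2 * B * (j + 1) - 1\<close>; it is good if \<open>G j\<close>, and its ramp then starts at \<open>a j\<close>.\<close>

definition climb :: "nat \<Rightarrow> (nat \<Rightarrow> bool) \<Rightarrow> (nat \<Rightarrow> int) \<Rightarrow> nat \<Rightarrow> int \<Rightarrow> real" where
  "climb B G a N z = (\<Prod>j<N. if G j then ramp B (a j) z else 1)"

lemma climb_ge_1: "1 \<le> climb B G a N z"
  unfolding climb_def by (intro prod_ge_1) (auto simp: ramp_ge_1)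

lemma climb_mono:
  assumes "y \<le> z" shows "climb B G a N y \<le> climb B G a N z"
  unfolding climb_def
  by (intro prod_mono) (auto simp: ramp_mono[OF assms] intro: order_trans[OF zero_le_one ramp_ge_1])

lemma climb_le:
  assumes "B > 0" shows "climb B G a N z \<le> 2 ^ N"
proof -
  have "climb B G a N z \<le> (\<Prod>j<N. 2)"
    unfolding climb_def
    by (intro prod_mono) (auto simp: ramp_le_2[OF assms] intro: order_trans[OF zero_le_one ramp_ge_1])
  then show ?thesis by simp
qed

context
  fixes B :: nat and G :: "nat \<Rightarrow> bool" and a :: "nat \<Rightarrow> int"
  assumes B: "B > 0"
    and a_ge: "\<And>j. G j \<Longrightarrow> int (2 * B * j) \<le> a j"
    and a_less: "\<And>j. G j \<Longrightarrow> a j < int (2 * B * j + B)"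
begin

lemma climb_0: "climb B G a N 0 = 1"
  unfolding climb_def
proof (intro prod.neutral ballI)
  fix j
  have "0 \<le> a j" if "G j" using a_ge[OF that] by linarith
  then show "(if G j then ramp B (a j) 0 else 1) = 1" by (simp add: ramp_left)
qed

lemma block_end:
  assumes "G j" "j < N" shows "a j + int B < int (2 * B * N)"
proof -
  have "2 * B * j + 2 * B \<le> 2 * B * N"
    using mult_le_mono2[of "Suc j" N "2 * B"] assms by simp
  then have "int (2 * B * j + B) + int B \<le> int (2 * B * N)" by linarith
  then show ?thesis using a_less[OF assms(1)] by linarith
qed

lemma climb_right:
  assumes "int (2 * B * N) \<le> z + 1"
  shows "climb B G a N z = (\<Prod>j<N. if G j then 2 else 1)"
  unfolding climb_def
proof (intro prod.cong refl)
  fix j assume "j \<in> {..<N}"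
  then have "ramp B (a j) z = 2" if "G j"
    using block_end[OF that, of N] assms by (intro ramp_right[OF B]) auto
  then show "(if G j then ramp B (a j) z else 1) = (if G j then 2 else 1)" by simp
qed

text \<open>At any site at most one of the ramps varies, as each of them ends before the next block starts. So
  the product inherits the estimate for a single ramp.\<close>

lemma climb_step:
  assumes w: "1 / 2 \<le> w" "w \<le> 1"
    and mid: "\<And>j. j < N \<Longrightarrow> G j \<Longrightarrow> a j < z \<Longrightarrow> z < a j + int B \<Longrightarrow> w = 1 / 2"
  shows "w * climb B G a N (z + 1) + (1 - w) * climb B G a N (z - 1)
    \<le> (1 + 1 / (real B)\<^sup>2) * climb B G a N z"
  using mid
proof (induction N)
  case 0
  then show ?case by (simp add: climb_def)
next
  case (Suc N)
  define c where "c = climb B G a N"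
  have Suc_eq: "climb B G a (Suc N) y = c y * (if G N then ramp B (a N) y else 1)" for y
    by (simp add: climb_def c_def)
  have IH: "w * c (z + 1) + (1 - w) * c (z - 1) \<le> (1 + 1 / (real B)\<^sup>2) * c z"
    unfolding c_def by (rule Suc.IH) (rule Suc.prems, auto)
  show ?case
  proof (cases "G N")
    case False
    then show ?thesis using IH by (simp add: Suc_eq)
  next
    case True
    show ?thesis
    proof (cases "z < int (2 * B * N)")
      case less: True
      then show ?thesis using IH a_ge[OF True] by (simp add: Suc_eq ramp_left)
    next
      case False
      then have "c (z + 1) = c z" "c (z - 1) = c z"
        unfolding c_def by (subst (1 2) climb_right; simp)+
      moreover have "c z * (w * ramp B (a N) (z + 1) + (1 - w) * ramp B (a N) (z - 1))
          \<le> c z * ((1 + 1 / (real B)\<^sup>2) * ramp B (a N) z)"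
        using ramp_step[OF B w, of "a N" z] Suc.prems[of N] True climb_ge_1[of B G a N z]
        by (intro mult_left_mono) (auto simp: c_def)
      ultimately show ?thesis using True by (simp add: Suc_eq algebra_simps)
    qed
  qed
qed

end

section \<open>Exponential moments and tails of the walk\<close>

lemma history_subalgebra:
  assumes "sets P = sets path_space"
  shows "subalgebra P (history n)"
proof -
  have sp: "space P = UNIV" using sets_eq_imp_space_eq[OF assms] by (simp add: path_space_def space_PiM)
  have "(\<lambda>Y. restrict Y {..n}) \<in> measurable P (\<Pi>\<^sub>M i\<in>{..n}. count_space (UNIV :: int set))"
    unfolding measurable_cong_sets[OF assms refl] path_space_def
    by (rule measurable_restrict_subset) simp
  then have "sets (history n) \<subseteq> sets P"
    unfolding history_def by (intro sets_image_in_sets) (auto simp: sp)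
  then show ?thesis by (simp add: subalgebra_def sp history_def)
qed

lemma coordinate_measurable_history:
  "(\<lambda>Y. Y n) \<in> measurable (history n) (count_space (UNIV :: int set))"
proof -
  have "(\<lambda>Y. restrict Y {..n}) \<in> measurable (history n) (\<Pi>\<^sub>M i\<in>{..n}. count_space (UNIV :: int set))"
    unfolding history_def by (rule measurable_vimage_algebra1) (auto simp: space_PiM)
  then have "(\<lambda>Y. (restrict Y {..n}) n) \<in> measurable (history n) (count_space (UNIV :: int set))"
    by (rule measurable_compose) (rule measurable_component_singleton, simp)
  then show ?thesis by simp
qed

lemma coordinate_measurable:
  assumes "sets P = sets path_space"
  shows "(\<lambda>Y. Y n) \<in> measurable P (count_space (UNIV :: int set))"
  unfolding measurable_cong_sets[OF assms refl] path_space_def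
  by (rule measurable_component_singleton) simp

lemma visits_pos: "visits Y n \<ge> 1"
proof -
  have "{i. i \<le> n \<and> Y i = Y n} \<noteq> {}" by auto
  then have "card {i. i \<le> n \<and> Y i = Y n} > 0" by (subst card_gt_0_iff) auto
  then show ?thesis by (simp add: visits_def)
qed

context
  fixes \<omega> :: env and y0 :: int and P :: "(nat \<Rightarrow> int) measure"
  assumes P: "erw_law \<omega> y0 P"
begin

text \<open>A bounded function whose one-step mean under every jump probability of the environment is at most \<open>l\<close>
  times its value grows in expectation at most by the factor \<open>l\<close> per step.\<close>

lemma erw_step_le:
  fixes f :: "int \<Rightarrow> real"
  assumes f: "\<And>z. \<bar>f z\<bar> \<le> C"
    and step: "\<And>z i. i \<ge> 1 \<Longrightarrow> \<omega> (z, i) * f (z + 1) + (1 - \<omega> (z, i)) * f (z - 1) \<le> l * f z"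
  shows "(\<integral>Y. f (Y (Suc n)) \<partial>P) \<le> l * (\<integral>Y. f (Y n) \<partial>P)"
proof -
  have sP: "sets P = sets path_space" using P by (simp add: erw_law_def)
  have spP: "space P = UNIV" using sets_eq_imp_space_eq[OF sP] by (simp add: path_space_def space_PiM)
  interpret prob_space P using P by (simp add: erw_law_def)
  interpret finite_measure_subalgebra P "history n"
    by unfold_locales (rule history_subalgebra[OF sP])
  note [measurable] = coordinate_measurable[OF sP]
  define U D :: "(nat \<Rightarrow> int) set" where "U = {Y. Y (Suc n) = Y n + 1}" and "D = {Y. Y (Suc n) = Y n - 1}"
  have "{Y \<in> space P. Y (Suc n) = Y n + 1} \<in> sets P" "{Y \<in> space P. Y (Suc n) = Y n - 1} \<in> sets P"
    by measurable
  then have UD [measurable]: "U \<in> sets P" "D \<in> sets P" by (simp_all add: U_def D_def spP)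
  define RU RD where "RU = real_cond_exp P (history n) (indicator U)"
    and "RD = real_cond_exp P (history n) (indicator D)"
  have RU: "AE Y in P. RU Y = \<omega> (Y n, visits Y n)" and RD: "AE Y in P. RD Y = 1 - \<omega> (Y n, visits Y n)"
    using P by (auto simp: erw_law_def RU_def RD_def U_def D_def)
  have [measurable]: "RU \<in> borel_measurable P" "RD \<in> borel_measurable P"
    by (simp_all add: RU_def RD_def)
  have int_ind: "integrable P (\<lambda>Y. g (Y n) * indicator S Y)"
    if "S \<in> sets P" "\<And>z. \<bar>g z\<bar> \<le> C" for g :: "int \<Rightarrow> real" and S C
  proof (rule integrable_const_bound[where B=C])
    have "0 \<le> C" using that(2)[of 0] by linarith
    then show "AE Y in P. norm (g (Y n) * indicator S Y) \<le> C"
      using that(2) by (auto simp: indicator_def)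
  qed (use that(1) in measurable)
  have gm: "(\<lambda>Y. g (Y n)) \<in> borel_measurable (history n)" for g :: "int \<Rightarrow> real"
    by (rule measurable_compose[OF coordinate_measurable_history]) simp
  have ce: "integrable P (\<lambda>Y. g (Y n) * real_cond_exp P (history n) (indicator S) Y)"
    "(\<integral>Y. g (Y n) * real_cond_exp P (history n) (indicator S) Y \<partial>P) = (\<integral>Y. g (Y n) * indicator S Y \<partial>P)"
    if "S \<in> sets P" "\<And>z. \<bar>g z\<bar> \<le> C" for g :: "int \<Rightarrow> real" and S C
    by (rule real_cond_exp_intg[OF int_ind[OF that] gm]; use that in measurable)+
  have fp: "\<bar>f (z + 1)\<bar> \<le> C" and fm: "\<bar>f (z - 1)\<bar> \<le> C" for z by (rule f)+
  have iU: "integrable P (\<lambda>Y. f (Y n + 1) * RU Y)"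
    unfolding RU_def by (rule ce(1)[of U "\<lambda>z. f (z + 1)", OF UD(1) fp])
  have iD: "integrable P (\<lambda>Y. f (Y n - 1) * RD Y)"
    unfolding RD_def by (rule ce(1)[of D "\<lambda>z. f (z - 1)", OF UD(2) fm])
  have UD_disj: "U \<inter> D = {}" by (auto simp: U_def D_def)
  \<comment> \<open>The two conditional probabilities add up to 1, so the walk almost surely makes a unit step.\<close>
  have "prob U + prob D = (\<integral>Y. RU Y \<partial>P) + (\<integral>Y. RD Y \<partial>P)"
    using ce(2)[of U "\<lambda>_. 1" 1] ce(2)[of D "\<lambda>_. 1" 1] UD by (simp add: RU_def RD_def spP)
  also have "\<dots> = (\<integral>Y. RU Y + RD Y \<partial>P)"
    using ce(1)[of U "\<lambda>_. 1" 1] ce(1)[of D "\<lambda>_. 1" 1] UD by (simp add: RU_def RD_def)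
  also have "\<dots> = (\<integral>Y. 1 \<partial>P)"
  proof (rule integral_cong_AE)
    show "AE Y in P. RU Y + RD Y = 1" using RU RD by eventually_elim simp
  qed measurable
  finally have "prob (U \<union> D) = 1"
    using UD_disj UD by (simp add: finite_measure_Union prob_space)
  then have AE_UD: "AE Y in P. Y \<in> U \<union> D" using UD by (intro AE_prob_1) auto
  have "(\<integral>Y. f (Y (Suc n)) \<partial>P) = (\<integral>Y. f (Y n + 1) * indicator U Y + f (Y n - 1) * indicator D Y \<partial>P)"
  proof (rule integral_cong_AE)
    show "AE Y in P. f (Y (Suc n)) = f (Y n + 1) * indicator U Y + f (Y n - 1) * indicator D Y"
      using AE_UD by eventually_elim (auto simp: U_def D_def indicator_def)
  qed measurable
  also have "\<dots> = (\<integral>Y. f (Y n + 1) * RU Y \<partial>P) + (\<integral>Y. f (Y n - 1) * RD Y \<partial>P)"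
    unfolding RU_def RD_def
      ce(2)[of U "\<lambda>z. f (z + 1)", OF UD(1) fp] ce(2)[of D "\<lambda>z. f (z - 1)", OF UD(2) fm]
    by (rule Bochner_Integration.integral_add
        [OF int_ind[of U "\<lambda>z. f (z + 1)", OF UD(1) fp] int_ind[of D "\<lambda>z. f (z - 1)", OF UD(2) fm]])
  also have "\<dots> = (\<integral>Y. f (Y n + 1) * RU Y + f (Y n - 1) * RD Y \<partial>P)"
    by (rule Bochner_Integration.integral_add[OF iU iD, symmetric])
  also have "\<dots> \<le> (\<integral>Y. l * f (Y n) \<partial>P)"
  proof (rule integral_mono_AE)
    show "integrable P (\<lambda>Y. f (Y n + 1) * RU Y + f (Y n - 1) * RD Y)"
      by (rule Bochner_Integration.integrable_add[OF iU iD])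
    show "integrable P (\<lambda>Y. l * f (Y n))"
      using f by (intro integrable_mult_right integrable_const_bound[where B=C]) auto
    show "AE Y in P. f (Y n + 1) * RU Y + f (Y n - 1) * RD Y \<le> l * f (Y n)"
      using RU RD by eventually_elim (use step[OF visits_pos] in \<open>simp add: mult.commute\<close>)
  qed
  finally show ?thesis by simp
qed

lemma erw_tail:
  fixes f :: "int \<Rightarrow> real"
  assumes f: "\<And>z. 0 \<le> f z" "\<And>z. f z \<le> C" and l: "0 \<le> l"
    and step: "\<And>z i. i \<ge> 1 \<Longrightarrow> \<omega> (z, i) * f (z + 1) + (1 - \<omega> (z, i)) * f (z - 1) \<le> l * f z"
    and S: "\<And>z. z \<in> S \<Longrightarrow> c \<le> f z"
  shows "c * measure P {Y. Y n \<in> S} \<le> l ^ n * f y0"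
proof -
  have sP: "sets P = sets path_space" using P by (simp add: erw_law_def)
  have spP: "space P = UNIV" using sets_eq_imp_space_eq[OF sP] by (simp add: path_space_def space_PiM)
  interpret prob_space P using P by (simp add: erw_law_def)
  note [measurable] = coordinate_measurable[OF sP]
  have fabs: "\<bar>f z\<bar> \<le> C" for z using f[of z] by simp
  have E: "(\<integral>Y. f (Y n) \<partial>P) \<le> l ^ n * f y0"
  proof (induction n)
    case 0
    have "prob {Y. Y 0 = y0} = 1" using P by (simp add: erw_law_def)
    then have "AE Y in P. Y \<in> {Y. Y 0 = y0}" by (intro AE_prob_1)
    then have "(\<integral>Y. f (Y 0) \<partial>P) = (\<integral>Y. f y0 \<partial>P)"
      by (intro integral_cong_AE) auto
    then show ?case by (simp add: prob_space)
  next
    case (Suc n)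
    have "(\<integral>Y. f (Y (Suc n)) \<partial>P) \<le> l * (\<integral>Y. f (Y n) \<partial>P)"
      by (rule erw_step_le[OF fabs step])
    also have "\<dots> \<le> l * (l ^ n * f y0)" using Suc l by (intro mult_left_mono)
    finally show ?case by simp
  qed
  have "{Y \<in> space P. Y n \<in> S} \<in> sets P" by measurable
  then have Sm: "{Y. Y n \<in> S} \<in> sets P" by (simp add: spP)
  have "c * prob {Y. Y n \<in> S} = (\<integral>Y. c * indicator {Y. Y n \<in> S} Y \<partial>P)"
    using Sm by (simp add: spP)
  also have "\<dots> \<le> (\<integral>Y. f (Y n) \<partial>P)"
  proof (rule integral_mono)
    show "integrable P (\<lambda>Y. c * indicator {Y. Y n \<in> S} Y)"
      using Sm by (intro integrable_mult_right) (simp add: spP integrable_indicator_iff emeasure_eq_measure)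
    show "integrable P (\<lambda>Y. f (Y n))"
      using fabs by (intro integrable_const_bound[where B=C]) auto
    show "c * indicator {Y. Y n \<in> S} Y \<le> f (Y n)" for Y
      using S[of "Y n"] f[of "Y n"] by (auto simp: indicator_def)
  qed
  finally show ?thesis using E by linarith
qed

end

text \<open>Good blocks contain an interval of \<open>B - 1\<close> sites where the walk is symmetric. Each good block
  halves the bound.\<close>

lemma erw_upper_tail:
  assumes P: "erw_law \<omega> 0 P"
    and \<omega>: "\<And>z i. i \<ge> 1 \<Longrightarrow> 1 / 2 \<le> \<omega> (z, i) \<and> \<omega> (z, i) \<le> 1"
    and B: "B > 0"
    and a: "\<And>j. G j \<Longrightarrow> int (2 * B * j) \<le> a j \<and> a j < int (2 * B * j + B)"
    and gap: "\<And>j z i. G j \<Longrightarrow> a j < z \<Longrightarrow> z < a j + int B \<Longrightarrow> i \<ge> 1 \<Longrightarrow> \<omega> (z, i) = 1 / 2"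
  shows "measure P {Y. int (2 * B * N) \<le> Y n}
    \<le> (1 + 1 / (real B)\<^sup>2) ^ n * (\<Prod>j<N. if G j then 1 / 2 else 1)"
proof -
  have a': "\<And>j. G j \<Longrightarrow> int (2 * B * j) \<le> a j" "\<And>j. G j \<Longrightarrow> a j < int (2 * B * j + B)"
    using a by auto
  let ?c = "\<Prod>j<N. if G j then 2 else 1 :: real"
  have "?c * measure P {Y. Y n \<in> {z. int (2 * B * N) \<le> z}} \<le> (1 + 1 / (real B)\<^sup>2) ^ n * climb B G a N 0"
  proof (rule erw_tail[OF P])
    show "0 \<le> climb B G a N z" for z using climb_ge_1[of B G a N z] by simp
    show "climb B G a N z \<le> 2 ^ N" for z by (rule climb_le[OF B])
    show "\<omega> (z, i) * climb B G a N (z + 1) + (1 - \<omega> (z, i)) * climb B G a N (z - 1)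
        \<le> (1 + 1 / (real B)\<^sup>2) * climb B G a N z" if "i \<ge> 1" for z i
      using \<omega>[OF that, of z] gap[of _ z i] that by (intro climb_step[OF B a']) auto
    show "?c \<le> climb B G a N z" if "z \<in> {z. int (2 * B * N) \<le> z}" for z
      using that by (subst climb_right[OF B a']) auto
  qed simp
  then have "?c * measure P {Y. int (2 * B * N) \<le> Y n} \<le> (1 + 1 / (real B)\<^sup>2) ^ n"
    by (simp add: climb_0[OF B a'])
  then have "(\<Prod>j<N. if G j then 1 / 2 else 1) * (?c * measure P {Y. int (2 * B * N) \<le> Y n})
      \<le> (\<Prod>j<N. if G j then 1 / 2 else 1) * (1 + 1 / (real B)\<^sup>2) ^ n"
    by (intro mult_left_mono prod_nonneg) auto
  moreover have "(\<Prod>j<N. if G j then 1 / 2 else 1) * ?c = 1"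
    unfolding prod.distrib[symmetric] by (intro prod.neutral) auto
  ultimately show ?thesis by (simp only: mult.assoc[symmetric] mult_1_left mult.commute[of "_ ^ n"])
qed

text \<open>The function \<open>climb\<close> reflected at \<open>0\<close> is nonincreasing, so among the jump probabilities \<open>w \<ge> 1 / 2\<close> the
  symmetric one is the worst; and in that case all blocks may be taken as good.\<close>

lemma erw_lower_tail:
  assumes P: "erw_law \<omega> 0 P"
    and \<omega>: "\<And>z i. i \<ge> 1 \<Longrightarrow> 1 / 2 \<le> \<omega> (z, i) \<and> \<omega> (z, i) \<le> 1"
    and B: "B > 0"
  shows "measure P {Y. Y n \<le> - int (2 * B * N)} \<le> (1 + 1 / (real B)\<^sup>2) ^ n * (1 / 2) ^ N"
proof -
  define c where "c = climb B (\<lambda>_. True) (\<lambda>j. int (2 * B * j)) N"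
  have a': "int (2 * B * j) \<le> int (2 * B * j)" "int (2 * B * j) < int (2 * B * j + B)" for j
    using B by auto
  have "2 ^ N * measure P {Y. Y n \<in> {z. z \<le> - int (2 * B * N)}} \<le> (1 + 1 / (real B)\<^sup>2) ^ n * c (- 0)"
  proof (rule erw_tail[OF P, where f="\<lambda>z. c (- z)"])
    show "0 \<le> c (- z)" for z unfolding c_def by (rule order_trans[OF zero_le_one climb_ge_1])
    show "c (- z) \<le> 2 ^ N" for z unfolding c_def by (rule climb_le[OF B])
    show "\<omega> (z, i) * c (- (z + 1)) + (1 - \<omega> (z, i)) * c (- (z - 1))
        \<le> (1 + 1 / (real B)\<^sup>2) * c (- z)" if "i \<ge> 1" for z i
    proof -
      have "c (- z - 1) \<le> c (- z + 1)" unfolding c_def by (rule climb_mono) simp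
      then have "(\<omega> (z, i) - 1 / 2) * (c (- z - 1) - c (- z + 1)) \<le> 0"
        using \<omega>[OF that, of z] by (intro mult_nonneg_nonpos) auto
      moreover have "1 / 2 * c (- z + 1) + (1 - 1 / 2) * c (- z - 1) \<le> (1 + 1 / (real B)\<^sup>2) * c (- z)"
        unfolding c_def by (rule climb_step[OF B a']) auto
      moreover have "\<omega> (z, i) * c (- z - 1) + (1 - \<omega> (z, i)) * c (- z + 1) =
          (\<omega> (z, i) - 1 / 2) * (c (- z - 1) - c (- z + 1)) + (1 / 2 * c (- z + 1) + (1 - 1 / 2) * c (- z - 1))"
        by (simp add: field_simps)
      ultimately have "\<omega> (z, i) * c (- z - 1) + (1 - \<omega> (z, i)) * c (- z + 1)
          \<le> (1 + 1 / (real B)\<^sup>2) * c (- z)" by linarith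
      moreover have "- (z + 1) = - z - 1" "- (z - 1) = - z + 1" by auto
      ultimately show ?thesis by (simp only:)
    qed
    show "2 ^ N \<le> c (- z)" if "z \<in> {z. z \<le> - int (2 * B * N)}" for z
    proof -
      have "c (- z) = (\<Prod>j<N. if True then 2 else 1)"
        unfolding c_def using that by (intro climb_right[OF B a']) auto
      then show ?thesis by simp
    qed
  qed simp
  moreover have "c (- 0) = 1" by (simp only: c_def minus_zero climb_0[OF B a'])
  ultimately have "2 ^ N * measure P {Y. Y n \<le> - int (2 * B * N)} \<le> (1 + 1 / (real B)\<^sup>2) ^ n"
    by (simp only: mult_1_right mem_Collect_eq)
  then show ?thesis by (simp add: power_divide field_simps)
qed

text \<open>The hypothesis \<open>D * x < y\<close> makes the terms at most \<open>exp y\<close> times those of a geometric series of ratio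
  \<open>exp (x - y / D) < 1\<close>.\<close>

lemma summable_geometric_div:
  fixes l r :: real
  assumes "0 \<le> l" "l \<le> exp x" "0 \<le> r" "r \<le> exp (- y)" "real D * x < y" "D > 0" "0 \<le> y"
  shows "summable (\<lambda>n. l ^ n * r ^ (n div D))"
proof (rule summable_comparison_test')
  define s where "s = exp (- (y / D - x))"
  have "0 < y / D - x" using assms by (simp add: field_simps)
  then have "s < 1" "0 \<le> s" by (auto simp: s_def)
  then show "summable (\<lambda>n. exp y * s ^ n)" by (intro summable_mult summable_geometric) auto
  fix n :: nat
  have "l ^ n * r ^ (n div D) \<le> exp x ^ n * exp (- y) ^ (n div D)"
    using assms by (intro mult_mono power_mono) auto
  also have "\<dots> = exp (real n * x - y * real (n div D))"
    by (simp add: exp_diff exp_minus field_simps flip: exp_of_nat_mult)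
  also have "\<dots> \<le> exp (real n * x - y * (real n / D - 1))"
  proof -
    have "real n < real D * (real (n div D) + 1)"
      using dividend_less_times_div[OF \<open>D > 0\<close>, of n] by (metis add.commute mult_Suc_right of_nat_Suc of_nat_less_iff of_nat_mult)
    then have "real n / D - 1 \<le> real (n div D)" using \<open>D > 0\<close> by (simp add: field_simps)
    then show ?thesis using \<open>0 \<le> y\<close> by (simp add: mult_left_mono)
  qed
  also have "\<dots> = exp y * s ^ n"
    by (simp add: s_def algebra_simps exp_diff exp_add exp_minus field_simps flip: exp_of_nat_mult)
  finally show "norm (l ^ n * r ^ (n div D)) \<le> exp y * s ^ n" using assms by simp
qed

lemma zero_speed_from_tails:
  assumes "prob_space P" and sP: "sets P = sets path_space"
    and up: "\<And>k. k > 0 \<Longrightarrow> summable (\<lambda>n. measure P {Y. real n \<le> real k * real_of_int (Y n)})"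
    and low: "\<And>k. k > 0 \<Longrightarrow> summable (\<lambda>n. measure P {Y. real k * real_of_int (Y n) \<le> - real n})"
  shows "AE Y in P. (\<lambda>n. real_of_int (Y n) / real n) \<longlonglongrightarrow> 0"
proof -
  have spP: "space P = UNIV" using sets_eq_imp_space_eq[OF sP] by (simp add: path_space_def space_PiM)
  interpret prob_space P by fact
  note [measurable] = coordinate_measurable[OF sP]
  have "{Y \<in> space P. real n \<le> real k * real_of_int (Y n)} \<in> sets P"
    "{Y \<in> space P. real k * real_of_int (Y n) \<le> - real n} \<in> sets P" for k n by measurable
  then have m: "{Y. real n \<le> real k * real_of_int (Y n)} \<in> sets P"
    "{Y. real k * real_of_int (Y n) \<le> - real n} \<in> sets P" for k n by (simp_all add: spP)
  have "AE Y in P. \<forall>k. eventually (\<lambda>n. \<bar>real (Suc k) * real_of_int (Y n)\<bar> < real n) sequentially"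
    unfolding AE_all_countable
  proof
    fix k
    have "AE Y in P. eventually (\<lambda>n. Y \<in> space P - {Y. real n \<le> real (Suc k) * real_of_int (Y n)}) sequentially"
      by (intro borel_cantelli_AE1 m up) (auto simp: emeasure_eq_measure)
    moreover have "AE Y in P. eventually (\<lambda>n. Y \<in> space P - {Y. real (Suc k) * real_of_int (Y n) \<le> - real n}) sequentially"
      by (intro borel_cantelli_AE1 m low) (auto simp: emeasure_eq_measure)
    ultimately show "AE Y in P. eventually (\<lambda>n. \<bar>real (Suc k) * real_of_int (Y n)\<bar> < real n) sequentially"
    proof eventually_elim
      case (elim Y)
      then show ?case by eventually_elim (unfold Diff_iff mem_Collect_eq, linarith)
    qed
  qed
  then show ?thesis
  proof eventually_elim
    case (elim Y)
    show ?case
    proof (rule LIMSEQ_I)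
      fix e :: real assume "e > 0"
      obtain k where k: "1 / real (Suc k) < e" using \<open>e > 0\<close> nat_approx_posE by blast
      obtain N where N: "\<And>n. n \<ge> N \<Longrightarrow> \<bar>real (Suc k) * real_of_int (Y n)\<bar> < real n"
        using elim[rule_format, of k] by (auto simp: eventually_sequentially)
      have "norm (real_of_int (Y n) / real n - 0) < e" if "n \<ge> N" for n
      proof -
        have "real (Suc k) * \<bar>real_of_int (Y n)\<bar> < real n" using N[OF that] by (simp add: abs_mult)
        moreover from this have "n > 0"
          by (metis abs_ge_zero gr0I mult_nonneg_nonneg not_le of_nat_0 of_nat_0_le_iff)
        ultimately have "\<bar>real_of_int (Y n)\<bar> / real n < 1 / real (Suc k)"
          by (simp add: field_simps del: of_nat_Suc)
        then show ?thesis using k by simp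
      qed
      then show "\<exists>N. \<forall>n\<ge>N. norm (real_of_int (Y n) / real n - 0) < e" by blast
    qed
  qed
qed

text \<open>For every \<open>k\<close> a block length \<open>B\<close> is needed such that the good blocks make the bound on
  \<open>P(Y n \<ge> n / k)\<close> summable: to reach \<open>n / k\<close> the walk has to cross \<open>n div (2 * B * k)\<close> blocks.\<close>

lemma erw_zero_speed:
  assumes P: "erw_law \<omega> 0 P"
    and \<omega>: "\<And>z i. i \<ge> 1 \<Longrightarrow> 1 / 2 \<le> \<omega> (z, i) \<and> \<omega> (z, i) \<le> 1"
    and gaps: "\<And>k. k > 0 \<Longrightarrow> \<exists>B G a. B > 0 \<and>
      (\<forall>j. G j \<longrightarrow> int (2 * B * j) \<le> a j \<and> a j < int (2 * B * j + B) \<and>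
        (\<forall>z i. a j < z \<longrightarrow> z < a j + int B \<longrightarrow> i \<ge> 1 \<longrightarrow> \<omega> (z, i) = 1 / 2)) \<and>
      summable (\<lambda>n. (1 + 1 / (real B)\<^sup>2) ^ n * (\<Prod>j<n div (2 * B * k). if G j then 1 / 2 else 1 :: real))"
  shows "AE Y in P. (\<lambda>n. real_of_int (Y n) / real n) \<longlonglongrightarrow> 0"
proof (rule zero_speed_from_tails)
  have sP: "sets P = sets path_space" using P by (simp add: erw_law_def)
  have spP: "space P = UNIV" using sets_eq_imp_space_eq[OF sP] by (simp add: path_space_def space_PiM)
  show "sets P = sets path_space" by (rule sP)
  show pP: "prob_space P" using P by (simp add: erw_law_def)
  interpret prob_space P by (rule pP)
  note [measurable] = coordinate_measurable[OF sP]
  have "{Y \<in> space P. m \<le> Y n} \<in> sets P" "{Y \<in> space P. Y n \<le> m} \<in> sets P" for m n by measurable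
  then have ms: "{Y. m \<le> Y n} \<in> sets P" "{Y. Y n \<le> m} \<in> sets P" for m n by (simp_all add: spP)
  have block: "int (2 * B * (n div (2 * B * k))) \<le> y"
    if "real n \<le> real k * real_of_int y" "k > 0" for B n k :: nat and y
  proof -
    have "2 * B * k * (n div (2 * B * k)) \<le> n" by (rule times_div_less_eq_dividend)
    then have "real k * real (2 * B * (n div (2 * B * k))) \<le> real n"
      by (metis mult.commute mult.left_commute of_nat_le_iff of_nat_mult)
    also note that(1)
    finally have "real (2 * B * (n div (2 * B * k))) \<le> real_of_int y" using \<open>k > 0\<close> by simp
    then show ?thesis by linarith
  qed
  fix k :: nat assume k: "k > 0"
  {
    obtain B G a where B: "B > 0"
      and a: "\<And>j. G j \<Longrightarrow> int (2 * B * j) \<le> a j \<and> a j < int (2 * B * j + B)"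
      and gap: "\<And>j z i. G j \<Longrightarrow> a j < z \<Longrightarrow> z < a j + int B \<Longrightarrow> i \<ge> 1 \<Longrightarrow> \<omega> (z, i) = 1 / 2"
      and sum: "summable (\<lambda>n. (1 + 1 / (real B)\<^sup>2) ^ n * (\<Prod>j<n div (2 * B * k). if G j then 1 / 2 else 1 :: real))"
    proof -
      from gaps[OF k] obtain B G a where "B > 0"
        and *: "\<forall>j. G j \<longrightarrow> int (2 * B * j) \<le> a j \<and> a j < int (2 * B * j + B) \<and>
          (\<forall>z i. a j < z \<longrightarrow> z < a j + int B \<longrightarrow> i \<ge> 1 \<longrightarrow> \<omega> (z, i) = 1 / 2)"
        and "summable (\<lambda>n. (1 + 1 / (real B)\<^sup>2) ^ n * (\<Prod>j<n div (2 * B * k). if G j then 1 / 2 else 1 :: real))"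
        by (elim exE conjE)
      then show thesis using that[of B G a] by simp
    qed
    show "summable (\<lambda>n. measure P {Y. real n \<le> real k * real_of_int (Y n)})"
    proof (rule summable_comparison_test'[OF sum])
      fix n :: nat
      have "measure P {Y. real n \<le> real k * real_of_int (Y n)}
          \<le> measure P {Y. int (2 * B * (n div (2 * B * k))) \<le> Y n}"
        using block[OF _ k] by (intro finite_measure_mono ms) auto
      also have "\<dots> \<le> (1 + 1 / (real B)\<^sup>2) ^ n * (\<Prod>j<n div (2 * B * k). if G j then 1 / 2 else 1)"
        by (rule erw_upper_tail[OF P \<omega> B a gap])
      finally show "norm (measure P {Y. real n \<le> real k * real_of_int (Y n)})
        \<le> (1 + 1 / (real B)\<^sup>2) ^ n * (\<Prod>j<n div (2 * B * k). if G j then 1 / 2 else 1)" by simp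
    qed
  }
  \<comment> \<open>The lower tail is summable once \<open>2 * k / B < 1 / 2\<close>.\<close>
  define B where "B = 4 * k + 1"
  have B: "B > 0" by (simp add: B_def)
  have sum: "summable (\<lambda>n. (1 + 1 / (real B)\<^sup>2) ^ n * (1 / 2) ^ (n div (2 * B * k)))"
  proof (rule summable_geometric_div)
    show "1 + 1 / (real B)\<^sup>2 \<le> exp (1 / (real B)\<^sup>2)" by (rule exp_ge_add_one_self)
    show "1 / 2 \<le> exp (- (1 / 2 :: real))" using exp_ge_add_one_self[of "- (1 / 2)"] by simp
    have "real (2 * B * k) * (1 / (real B)\<^sup>2) = 2 * real k / real B"
      using B by (simp add: field_simps power2_eq_square)
    also have "\<dots> < 1 / 2" using B by (simp add: field_simps B_def)
    finally show "real (2 * B * k) * (1 / (real B)\<^sup>2) < 1 / 2" .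
  qed (use B k in auto)
  show "summable (\<lambda>n. measure P {Y. real k * real_of_int (Y n) \<le> - real n})"
  proof (rule summable_comparison_test'[OF sum])
    fix n :: nat
    have "measure P {Y. real k * real_of_int (Y n) \<le> - real n}
        \<le> measure P {Y. Y n \<le> - int (2 * B * (n div (2 * B * k)))}"
    proof (intro finite_measure_mono ms subsetI CollectI)
      fix Y assume "Y \<in> {Y. real k * real_of_int (Y n) \<le> - real n}"
      then show "Y n \<le> - int (2 * B * (n div (2 * B * k)))"
        using block[of n k "- Y n" B] k by simp
    qed
    also have "\<dots> \<le> (1 + 1 / (real B)\<^sup>2) ^ n * (1 / 2) ^ (n div (2 * B * k))"
      by (rule erw_lower_tail[OF P \<omega> B])
    finally show "norm (measure P {Y. real k * real_of_int (Y n) \<le> - real n})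
      \<le> (1 + 1 / (real B)\<^sup>2) ^ n * (1 / 2) ^ (n div (2 * B * k))" by simp
  qed
qed

section \<open>The random environment\<close>

text \<open>Independent uniform variables on \<open>[0, 1]\<close>, indexed like the environment itself so that \<open>env_shift\<close> also
  acts on them. The variable with index \<open>(a, Suc n)\<close> belongs to site \<open>a\<close> and level \<open>n\<close>.\<close>

definition noise :: "env measure" where
  "noise = (\<Pi>\<^sub>M zi \<in> UNIV \<times> {1..}. restrict_space lborel {0..1})"

text \<open>Site \<open>a\<close> fires at level \<open>n\<close>, an event of probability \<open>3^-n / 6\<close>.\<close>

definition fires :: "env \<Rightarrow> nat \<Rightarrow> int \<Rightarrow> bool" where
  "fires x n a \<longleftrightarrow> x (a, Suc n) \<le> (1 / 3) ^ n / 6"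

text \<open>Site \<open>z\<close> lies in an interval \<open>[a, a + 2^n)\<close> that is cleared of cookies because \<open>a\<close> fires at level \<open>n\<close>.\<close>

definition covered :: "env \<Rightarrow> int \<Rightarrow> bool" where
  "covered x z \<longleftrightarrow> (\<exists>n. \<exists>k<2 ^ n. fires x n (z - int k))"

text \<open>A site has no cookies at all if it is covered, and infinitely many otherwise.\<close>

definition cookie_number :: "int \<Rightarrow> env \<Rightarrow> enat" where
  "cookie_number z x = (if covered x z then 0 else \<infinity>)"

text \<open>The resulting environment with jump parameter \<open>p\<close>.\<close>

definition cookie_env :: "real \<Rightarrow> env \<Rightarrow> env" where
  "cookie_env p x = (\<lambda>(z, i) \<in> UNIV \<times> {1..}. if covered x z then 1 / 2 else p)"

lemma prob_space_unit: "prob_space (restrict_space lborel {0..1::real})"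
  by (rule prob_spaceI) (simp add: emeasure_restrict_space)

lemma sets_noise: "sets noise = sets env_space"
  unfolding noise_def env_space_def
  by (intro sets_PiM_cong refl sets_restrict_space_cong) simp

lemma space_noise: "space noise = space env_space"
  by (rule sets_eq_imp_space_eq[OF sets_noise])

interpretation noise: prob_space noise
  unfolding noise_def by (intro prob_space_PiM prob_space_unit)

lemma fires_measurable [measurable]: "Measurable.pred noise (\<lambda>x. fires x n a)"
proof -
  have "(\<lambda>x. x (a, Suc n)) \<in> measurable noise (restrict_space lborel {0..1})"
    unfolding noise_def by (rule measurable_component_singleton) simp
  then have [measurable]: "(\<lambda>x. x (a, Suc n)) \<in> borel_measurable noise"
    by (simp add: measurable_restrict_space2_iff)
  show ?thesis unfolding fires_def by measurable
qed

lemma covered_measurable [measurable]: "Measurable.pred noise (\<lambda>x. covered x z)"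
  unfolding covered_def by measurable

lemma prob_no_fires:
  assumes "finite S"
  shows "noise.prob {x \<in> space noise. \<forall>a\<in>S. \<not> fires x n a} = (1 - (1 / 3) ^ n / 6) ^ card S"
proof -
  define q :: real where "q = (1 / 3) ^ n / 6"
  have q: "0 \<le> q" "q \<le> 1" using power_le_one[of "1 / 3 :: real" n] by (auto simp: q_def)
  let ?U = "restrict_space lborel {0..1::real}" and ?J = "(\<lambda>a. (a, Suc n)) ` S"
  have inj: "inj_on (\<lambda>a. (a, Suc n)) S" by (auto simp: inj_on_def)
  have A: "{q<..1} \<in> sets ?U" using q
    by (subst sets_restrict_space_iff) auto
  have "{x \<in> space noise. \<forall>a\<in>S. \<not> fires x n a} = prod_emb (UNIV \<times> {1..}) (\<lambda>_. ?U) ?J (Pi\<^sub>E ?J (\<lambda>_. {q<..1}))"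
  proof -
    have sp: "(\<Pi>\<^sub>E i\<in>UNIV \<times> {1..}. space ?U) = space noise" by (simp add: noise_def space_PiM)
    have "x (a, Suc n) \<le> 1" if "x \<in> space noise" for x a
      using that by (auto simp: space_restrict_space PiE_iff simp flip: sp)
    then show ?thesis
      unfolding prod_emb_def sp by (auto simp: fires_def q_def not_le PiE_iff)
  qed
  also have "emeasure noise \<dots> = (\<Prod>i\<in>?J. emeasure ?U {q<..1})"
    unfolding noise_def by (rule emeasure_PiM_emb) (use assms A in \<open>auto intro: prob_space_unit\<close>)
  also have "emeasure ?U {q<..1} = ennreal (1 - q)"
    using q by (subst emeasure_restrict_space) auto
  also have "(\<Prod>i\<in>?J. ennreal (1 - q)) = ennreal ((1 - q) ^ card S)"
    using q by (simp add: card_image[OF inj] ennreal_power)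
  finally show ?thesis using q by (simp add: measure_def q_def)
qed

lemma prob_fires: "noise.prob {x \<in> space noise. fires x n a} = (1 / 3) ^ n / 6"
  using noise.prob_neg[of "\<lambda>x. fires x n a"] prob_no_fires[of "{a}" n] by simp

text \<open>Union bound over the \<open>2^n\<close> sites of each level \<open>n\<close> that can cover \<open>z\<close>.\<close>

lemma prob_covered_le: "noise.prob {x \<in> space noise. covered x z} \<le> 1 / 2"
proof -
  let ?C = "\<lambda>n. \<Union>k<2 ^ n. {x \<in> space noise. fires x n (z - int k)}"
  have C: "noise.prob (?C n) \<le> (2 / 3) ^ n / 6" for n
  proof -
    have "noise.prob (?C n) \<le> (\<Sum>k<2 ^ n. noise.prob {x \<in> space noise. fires x n (z - int k)})"
      by (intro noise.finite_measure_subadditive_finite) auto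
    also have "\<dots> = (2 / 3) ^ n / 6" by (simp add: prob_fires power_divide)
    finally show ?thesis .
  qed
  have geo: "summable (\<lambda>n. (2 / 3 :: real) ^ n / 6)" by (intro summable_divide summable_geometric) simp
  then have sum: "summable (\<lambda>n. noise.prob (?C n))"
    by (rule summable_comparison_test') (use C in auto)
  have "{x \<in> space noise. covered x z} = (\<Union>n. ?C n)" by (auto simp: covered_def)
  also have "noise.prob (\<Union>n. ?C n) \<le> (\<Sum>n. noise.prob (?C n))"
    by (intro noise.finite_measure_subadditive_countably sum) auto
  also have "\<dots> \<le> (\<Sum>n. (2 / 3) ^ n / 6)" by (intro suminf_le C sum geo)
  also have "\<dots> = 1 / 2" by (subst suminf_divide) (auto simp: suminf_geometric)
  finally show ?thesis .
qed

lemma cookie_number_infinite: "(\<integral>\<^sup>+ x. ennreal_of_enat (cookie_number z x) \<partial>noise) = \<infinity>"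
proof -
  let ?F = "{x \<in> space noise. \<not> covered x z}"
  have "(\<integral>\<^sup>+ x. ennreal_of_enat (cookie_number z x) \<partial>noise) = (\<integral>\<^sup>+ x. \<infinity> * indicator ?F x \<partial>noise)"
    by (intro nn_integral_cong) (auto simp: cookie_number_def)
  also have "\<dots> = \<infinity> * emeasure noise ?F" by (rule nn_integral_cmult_indicator) measurable
  also have "emeasure noise ?F > 0"
    using noise.prob_neg[of "\<lambda>x. covered x z"] prob_covered_le[of z]
    by (simp add: noise.emeasure_eq_measure)
  then have "\<infinity> * emeasure noise ?F = \<infinity>" by (simp add: ennreal_top_mult)
  finally show ?thesis .
qed

lemma cookie_env_measurable:
  assumes "0 \<le> p" "p \<le> 1"
  shows "cookie_env p \<in> measurable noise env_space"
  unfolding env_space_def cookie_env_def split_def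
proof (rule measurable_restrict)
  fix zi :: "int \<times> nat"
  show "(\<lambda>x. if covered x (fst zi) then 1 / 2 else p) \<in> measurable noise (restrict_space borel {0..1})"
    using assms by (intro measurable_restrict_space2) auto
qed

lemma random_cookie_env_noise:
  assumes "0 \<le> p" "p \<le> 1"
  shows "random_cookie_env p noise (cookie_env p) cookie_number"
  unfolding random_cookie_env_def
proof (intro conjI allI ballI impI)
  show "prob_space noise" by (rule noise.prob_space_axioms)
  show "cookie_env p \<in> measurable noise env_space" by (rule cookie_env_measurable[OF assms])
  show "cookie_number z \<in> measurable noise (count_space UNIV)" for z
    unfolding cookie_number_def by measurable
  show "cookie_env p x (z, i) = (if enat i \<le> cookie_number z x then p else 1 / 2)" if "i \<ge> 1" for x z i
    using that by (simp add: cookie_env_def cookie_number_def zero_enat_def)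
qed

lemma env_shift_eq:
  assumes "x \<in> space env_space"
  shows "env_shift x = (\<lambda>zi \<in> UNIV \<times> {1..}. x (fst zi + 1, snd zi))"
proof
  fix zi :: "int \<times> nat"
  obtain z i where zi: "zi = (z, i)" by (cases zi)
  have "x \<in> extensional (UNIV \<times> {1..})" using assms by (auto simp: env_space_def space_PiM PiE_def)
  then have "x (z + 1, i) = undefined" if "i = 0" using that by (simp add: extensional_def)
  then show "env_shift x zi = (\<lambda>zi \<in> UNIV \<times> {1..}. x (fst zi + 1, snd zi)) zi"
    by (cases "i = 0") (auto simp: env_shift_def zi)
qed

lemma env_shift_measurable: "env_shift \<in> measurable env_space env_space"
proof -
  have "(\<lambda>x. \<lambda>zi \<in> UNIV \<times> {1..}. x (fst zi + 1, snd zi)) \<in> measurable env_space env_space"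
    unfolding env_space_def by (intro measurable_restrict measurable_component_singleton) auto
  then show ?thesis by (subst measurable_cong[OF env_shift_eq])
qed

lemma cookie_env_shift: "cookie_env p (env_shift x) = env_shift (cookie_env p x)"
proof -
  have "fires (env_shift x) n a = fires x n (a + 1)" for n a by (simp add: fires_def env_shift_def)
  then have "covered (env_shift x) z = covered x (z + 1)" for z
    by (simp add: covered_def algebra_simps)
  then show ?thesis by (auto simp: cookie_env_def env_shift_def fun_eq_iff)
qed

lemma noise_shift_invariant: "distr noise env_space env_shift = noise"
proof -
  let ?\<sigma> = "\<lambda>zi :: int \<times> nat. (fst zi + 1, snd zi)"
  have "distr noise env_space env_shift = distr noise noise (\<lambda>x. \<lambda>zi \<in> UNIV \<times> {1..}. x (?\<sigma> zi))"
    by (intro distr_cong refl env_shift_eq) (simp_all add: sets_noise space_noise)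
  also have "\<dots> = noise"
    unfolding noise_def by (rule PiM_reindex_invariant[OF prob_space_unit]) (auto simp: inj_on_def)
  finally show ?thesis .
qed

lemma noise_zero_one:
  assumes A: "A \<in> sets noise" "env_shift -` A \<inter> space noise = A"
  shows "noise.prob A = 0 \<or> noise.prob A = 1"
proof -
  let ?\<sigma> = "\<lambda>zi :: int \<times> nat. (fst zi + 1, snd zi)"
  have \<sigma>k: "(?\<sigma> ^^ k) zi = (fst zi + int k, snd zi)" for k zi
    by (induction k) auto
  show ?thesis
    unfolding noise_def
  proof (rule bernoulli_shift_zero_one[OF prob_space_unit, where \<sigma>="?\<sigma>"])
    show "\<exists>k. (?\<sigma> ^^ k) ` J \<inter> J = {}" if "finite J" for J
    proof -
      have "finite ((\<lambda>(u, v). fst u - fst v) ` (J \<times> J))" using that by simp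
      then obtain b where b: "\<And>t. t \<in> (\<lambda>(u, v). fst u - fst v) ` (J \<times> J) \<Longrightarrow> t \<le> b"
        using finite_has_maximal by (metis bdd_above.E bdd_above_finite)
      have "(?\<sigma> ^^ nat (b + 1)) u \<noteq> v" if "u \<in> J" "v \<in> J" for u v
      proof
        assume "(?\<sigma> ^^ nat (b + 1)) u = v"
        then have "fst v - fst u = int (nat (b + 1))" by (auto simp: \<sigma>k)
        moreover have "fst v - fst u \<le> b" by (rule b) (use that in force)
        ultimately show False by linarith
      qed
      then show ?thesis by blast
    qed
    show "A \<in> sets (\<Pi>\<^sub>M i\<in>UNIV \<times> {1..}. restrict_space lborel {0..1})" using A by (simp add: noise_def)
    have "(\<lambda>x. \<lambda>zi \<in> UNIV \<times> {1..}. x (?\<sigma> zi)) -` A \<inter> space noise = env_shift -` A \<inter> space noise"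
      using env_shift_eq by (auto simp: space_noise)
    then show "(\<lambda>x. \<lambda>zi \<in> UNIV \<times> {1..}. x (?\<sigma> zi)) -` A \<inter> space (\<Pi>\<^sub>M i\<in>UNIV \<times> {1..}. restrict_space lborel {0..1}) = A"
      using A by (simp add: noise_def)
  qed (auto simp: inj_on_def)
qed

lemma ergodic_cookie_env:
  assumes "0 \<le> p" "p \<le> 1"
  shows "ergodic_law (distr noise env_space (cookie_env p))"
  unfolding ergodic_law_def
proof (intro conjI ballI impI)
  note m = cookie_env_measurable[OF assms]
  have shift_m: "env_shift \<in> measurable noise env_space"
    using env_shift_measurable by (simp add: measurable_cong_sets[OF sets_noise refl])
  show "prob_space (distr noise env_space (cookie_env p))" by (rule noise.prob_space_distr[OF m])
  have "distr (distr noise env_space (cookie_env p)) env_space env_shift = distr noise env_space (cookie_env p \<circ> env_shift)"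
    by (simp add: distr_distr[OF env_shift_measurable m] comp_def cookie_env_shift)
  also have "\<dots> = distr (distr noise env_space env_shift) env_space (cookie_env p)"
    using m shift_m by (subst distr_distr) (auto simp: measurable_cong_sets[OF sets_noise refl])
  finally show "distr (distr noise env_space (cookie_env p)) env_space env_shift = distr noise env_space (cookie_env p)"
    by (simp add: noise_shift_invariant)
  fix A assume A: "A \<in> sets env_space" "env_shift -` A \<inter> space env_space = A"
  let ?A = "cookie_env p -` A \<inter> space noise"
  have "env_shift -` ?A \<inter> space noise = cookie_env p -` (env_shift -` A \<inter> space env_space) \<inter> space noise"
    using measurable_space[OF shift_m] measurable_space[OF m] by (auto simp: cookie_env_shift space_noise)
  then have "noise.prob ?A = 0 \<or> noise.prob ?A = 1"
    using A measurable_sets[OF m] by (intro noise_zero_one) auto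
  then show "measure (distr noise env_space (cookie_env p)) A = 0 \<or> measure (distr noise env_space (cookie_env p)) A = 1"
    by (simp add: measure_distr[OF m A(1)])
qed simp

text \<open>Block \<open>j\<close> of length \<open>2 * 2^n\<close> is good if a site in its first half fires at level \<open>n\<close>. The interval cleared
  by this site then stays inside the block.\<close>

definition good_block :: "env \<Rightarrow> nat \<Rightarrow> nat \<Rightarrow> bool" where
  "good_block x n j \<longleftrightarrow> (\<exists>k<2 ^ n. fires x n (int (2 * 2 ^ n * j + k)))"

lemma good_block_measurable [measurable]: "Measurable.pred noise (\<lambda>x. good_block x n j)"
  unfolding good_block_def by measurable

text \<open>With \<open>B = 2^n\<close> and \<open>q = 3^-n / 6\<close> the probability is \<open>1 - (1 - q)^B\<close>, and Bernoulli's inequality gives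
  \<open>(1 - q)^B \<le> 1 / (1 + q)^B \<le> 1 / (1 + B * q)\<close>.\<close>

lemma prob_good_block_ge: "(2 / 3) ^ n / 12 \<le> noise.prob {x \<in> space noise. good_block x n j}"
proof -
  define q :: real where "q = (1 / 3) ^ n / 6"
  define b :: real where "b = 2 ^ n * q"
  have q: "0 \<le> q" "q \<le> 1" using power_le_one[of "1 / 3 :: real" n] by (auto simp: q_def)
  have b_eq: "b = (2 / 3) ^ n / 6" by (simp add: b_def q_def power_divide)
  have b: "0 \<le> b" "b \<le> 1" using power_le_one[of "2 / 3 :: real" n] by (auto simp: b_eq)
  let ?S = "(\<lambda>k. int (2 * 2 ^ n * j + k)) ` {..<2 ^ n}"
  have card: "card ?S = 2 ^ n" by (subst card_image) (auto simp: inj_on_def)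
  have "{x \<in> space noise. \<not> good_block x n j} = {x \<in> space noise. \<forall>a\<in>?S. \<not> fires x n a}"
    by (auto simp: good_block_def)
  also have "noise.prob \<dots> = (1 - q) ^ card ?S"
    unfolding q_def by (rule prob_no_fires) simp
  finally have "noise.prob {x \<in> space noise. \<not> good_block x n j} = (1 - q) ^ 2 ^ n"
    by (simp only: card)
  moreover have "(1 - q) ^ 2 ^ n \<le> 1 / (1 + b)"
  proof -
    have "1 + b \<le> (1 + q) ^ 2 ^ n"
      using Bernoulli_inequality[of q "2 ^ n"] q by (simp add: b_def)
    then have "(1 - q) ^ 2 ^ n * (1 + b) \<le> (1 - q) ^ 2 ^ n * (1 + q) ^ 2 ^ n"
      using q by (intro mult_left_mono) auto
    also have "\<dots> = ((1 - q) * (1 + q)) ^ 2 ^ n" by (simp add: power_mult_distrib)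
    also have "\<dots> \<le> 1" using q by (intro power_le_one) (auto simp: algebra_simps mult_le_one)
    finally show ?thesis using b by (simp add: field_simps)
  qed
  moreover have "1 / (1 + b) \<le> 1 - b / 2"
  proof -
    have "1 \<le> (1 - b / 2) * (1 + b)" using mult_left_mono[of b 1 b] b by (simp add: algebra_simps)
    then show ?thesis using b by (simp add: field_simps)
  qed
  ultimately show ?thesis
    using noise.prob_neg[of "\<lambda>x. good_block x n j"] by (simp add: b_eq)
qed

text \<open>Different blocks read disjoint sets of noise variables, so the mean of the product factorises.\<close>

lemma nn_integral_good_block_prod_le:
  "(\<integral>\<^sup>+x. ennreal (\<Prod>j<N. if good_block x n j then 1 / 2 else 1) \<partial>noise) \<le> ennreal ((1 - (2 / 3) ^ n / 24) ^ N)"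
proof -
  let ?U = "restrict_space lborel {0..1::real}"
  define u :: "nat \<Rightarrow> env \<Rightarrow> ennreal" where "u j x = (if good_block x n j then 1 / 2 else 1)" for j x
  define K where "K j = (\<lambda>k. (int (2 * 2 ^ n * j + k), Suc n)) ` {..<2 ^ n}" for j :: nat
  have iv: "noise.indep_vars (\<lambda>_. ?U) (\<lambda>i x. x i) (UNIV \<times> {1..})"
    unfolding noise_def by (rule prob_space_indep_coordinates[OF prob_space_unit]) auto
  have disj: "disjoint_family_on K {..<N}"
  proof -
    have "j = j'" if "2 * 2 ^ n * j + k = 2 * 2 ^ n * j' + k'" "k < 2 ^ n" "k' < 2 ^ n" for j j' k k' :: nat
    proof -
      have "(2 * 2 ^ n * j + k) div (2 * 2 ^ n) = j" "(2 * 2 ^ n * j' + k') div (2 * 2 ^ n) = j'"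
        using that(2,3) by (auto simp: div_mult_self4)
      then show ?thesis using that(1) by simp
    qed
    then show ?thesis by (auto simp: disjoint_family_on_def K_def simp flip: of_nat_add of_nat_mult)
  qed
  have "noise.indep_vars (\<lambda>j. \<Pi>\<^sub>M i\<in>K j. ?U) (\<lambda>j x. restrict (\<lambda>i. x i) (K j)) {..<N}"
    by (rule noise.indep_vars_restrict[OF iv _ disj]) (auto simp: K_def)
  then have "noise.indep_vars (\<lambda>_. borel) (\<lambda>j x. u j (restrict x (K j))) {..<N}"
  proof (rule noise.indep_vars_compose2)
    fix j
    have "Measurable.pred (\<Pi>\<^sub>M i\<in>K j. ?U) (\<lambda>x. x i \<le> (1 / 3) ^ n / 6)" if "i \<in> K j" for i
    proof -
      have "(\<lambda>x. x i) \<in> measurable (\<Pi>\<^sub>M i\<in>K j. ?U) ?U" by (rule measurable_component_singleton[OF that])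
      then have [measurable]: "(\<lambda>x. x i) \<in> borel_measurable (\<Pi>\<^sub>M i\<in>K j. ?U)"
        by (simp add: measurable_restrict_space2_iff)
      show ?thesis by measurable
    qed
    then have "Measurable.pred (\<Pi>\<^sub>M i\<in>K j. ?U) (\<lambda>x. \<exists>i\<in>K j. x i \<le> (1 / 3) ^ n / 6)"
      by (intro pred_intros_finite) (auto simp: K_def)
    moreover have "good_block x n j \<longleftrightarrow> (\<exists>i\<in>K j. x i \<le> (1 / 3) ^ n / 6)" for x
      by (auto simp: good_block_def K_def fires_def)
    ultimately show "u j \<in> borel_measurable (\<Pi>\<^sub>M i\<in>K j. ?U)" unfolding u_def by simp
  qed
  also have "(\<lambda>j x. u j (restrict x (K j))) = u"
  proof -
    have "good_block (restrict x (K j)) n j = good_block x n j" for x j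
      by (force simp: good_block_def fires_def K_def)
    then show ?thesis by (simp add: u_def fun_eq_iff)
  qed
  finally have "(\<integral>\<^sup>+x. (\<Prod>j<N. u j x) \<partial>noise) = (\<Prod>j<N. \<integral>\<^sup>+x. u j x \<partial>noise)"
    by (intro noise.indep_vars_nn_integral) auto
  also have "\<dots> \<le> (\<Prod>j<N. ennreal (1 - (2 / 3) ^ n / 24))"
  proof (intro prod_mono_ennreal)
    fix j
    let ?G = "{x \<in> space noise. good_block x n j}"
    have "(\<integral>\<^sup>+x. u j x \<partial>noise) = (\<integral>\<^sup>+x. ennreal (1 - indicator ?G x / 2) \<partial>noise)"
      by (intro nn_integral_cong) (auto simp: u_def ennreal_divide_numeral simp flip: ennreal_1)
    also have "\<dots> = ennreal (\<integral>x. 1 - indicator ?G x / 2 \<partial>noise)"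
      by (intro nn_integral_eq_integral noise.integrable_const_bound[where B=1])
        (auto simp: indicator_def)
    also have "(\<integral>x. 1 - indicator ?G x / 2 \<partial>noise) = 1 - noise.prob ?G / 2"
      by (subst Bochner_Integration.integral_diff) (auto simp: noise.prob_space noise.emeasure_eq_measure)
    also have "ennreal \<dots> \<le> ennreal (1 - (2 / 3) ^ n / 24)"
      using prob_good_block_ge[of n j] by (intro ennreal_leI) simp
    finally show "(\<integral>\<^sup>+x. u j x \<partial>noise) \<le> ennreal (1 - (2 / 3) ^ n / 24)" .
  qed
  also have "\<dots> = ennreal ((1 - (2 / 3) ^ n / 24) ^ N)"
    using power_le_one[of "2 / 3 :: real" n] by (simp add: ennreal_power)
  also have "(\<integral>\<^sup>+x. (\<Prod>j<N. u j x) \<partial>noise) = (\<integral>\<^sup>+x. ennreal (\<Prod>j<N. if good_block x n j then 1 / 2 else 1) \<partial>noise)"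
  proof (intro nn_integral_cong)
    fix x
    have "u j x = ennreal (if good_block x n j then 1 / 2 else 1)" for j
      by (auto simp: u_def ennreal_divide_numeral simp flip: ennreal_1)
    then show "(\<Prod>j<N. u j x) = ennreal (\<Prod>j<N. if good_block x n j then 1 / 2 else 1)"
      by (simp add: prod_ennreal)
  qed
  finally show ?thesis .
qed

text \<open>The mean over the noise of the bound in \<open>erw_upper_tail\<close> is summable, hence so is the bound itself for
  almost every realisation.\<close>

lemma AE_summable_good_block:
  assumes k: "k > 0" and n: "48 * real k < (4 / 3) ^ n"
  shows "AE x in noise. summable (\<lambda>m. (1 + 1 / (real (2 ^ n))\<^sup>2) ^ m *
    (\<Prod>j<m div (2 * 2 ^ n * k). if good_block x n j then 1 / 2 else 1 :: real))"
proof -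
  define l where "l = 1 + 1 / (real (2 ^ n))\<^sup>2"
  define r :: real where "r = 1 - (2 / 3) ^ n / 24"
  define v where "v m x = l ^ m * (\<Prod>j<m div (2 * 2 ^ n * k). if good_block x n j then 1 / 2 else 1 :: real)" for m x
  have l: "0 \<le> l" by (simp add: l_def)
  have r: "0 \<le> r" using power_le_one[of "2 / 3 :: real" n] by (simp add: r_def)
  have v: "0 \<le> v m x" for m x unfolding v_def using l by (intro mult_nonneg_nonneg prod_nonneg) auto
  have [measurable]: "v m \<in> borel_measurable noise" for m unfolding v_def by measurable
  have sum: "summable (\<lambda>m. l ^ m * r ^ (m div (2 * 2 ^ n * k)))"
  proof (rule summable_geometric_div)
    show "l \<le> exp (1 / (real (2 ^ n))\<^sup>2)" unfolding l_def by (rule exp_ge_add_one_self)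
    show "r \<le> exp (- ((2 / 3) ^ n / 24))" unfolding r_def
      using exp_ge_add_one_self[of "- ((2 / 3) ^ n / 24)"] by simp
    have "real (2 * 2 ^ n * k) * (1 / (real (2 ^ n))\<^sup>2) = 2 * real k / 2 ^ n"
      by (simp add: power2_eq_square)
    also have "\<dots> < (4 / 3) ^ n / 24 / 2 ^ n"
      using n by (intro divide_strict_right_mono) auto
    also have "\<dots> = (2 / 3) ^ n / 24"
    proof -
      have "(4 / 3) ^ n = (2 / 3) ^ n * (2 :: real) ^ n" by (simp flip: power_mult_distrib)
      then show ?thesis by simp
    qed
    finally show "real (2 * 2 ^ n * k) * (1 / (real (2 ^ n))\<^sup>2) < (2 / 3) ^ n / 24" .
  qed (use l r k in auto)
  have "(\<integral>\<^sup>+x. (\<Sum>m. ennreal (v m x)) \<partial>noise) = (\<Sum>m. \<integral>\<^sup>+x. ennreal (v m x) \<partial>noise)"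
    by (intro nn_integral_suminf) measurable
  also have "\<dots> \<le> (\<Sum>m. ennreal (l ^ m * r ^ (m div (2 * 2 ^ n * k))))"
  proof (intro suminf_le)
    fix m
    let ?N = "m div (2 * 2 ^ n * k)"
    have "(\<integral>\<^sup>+x. ennreal (v m x) \<partial>noise) =
        (\<integral>\<^sup>+x. ennreal (l ^ m) * ennreal (\<Prod>j<?N. if good_block x n j then 1 / 2 else 1) \<partial>noise)"
      using l by (intro nn_integral_cong) (simp add: v_def ennreal_mult prod_nonneg)
    also have "\<dots> = ennreal (l ^ m) * (\<integral>\<^sup>+x. ennreal (\<Prod>j<?N. if good_block x n j then 1 / 2 else 1) \<partial>noise)"
      by (intro nn_integral_cmult) measurable
    also have "\<dots> \<le> ennreal (l ^ m) * ennreal (r ^ ?N)"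
      unfolding r_def by (intro mult_left_mono nn_integral_good_block_prod_le) simp
    also have "\<dots> = ennreal (l ^ m * r ^ ?N)" using l r by (simp add: ennreal_mult)
    finally show "(\<integral>\<^sup>+x. ennreal (v m x) \<partial>noise) \<le> ennreal (l ^ m * r ^ ?N)" .
  qed auto
  also have "\<dots> = ennreal (\<Sum>m. l ^ m * r ^ (m div (2 * 2 ^ n * k)))"
    using l r sum by (intro suminf_ennreal2) auto
  also have "\<dots> < \<infinity>" by simp
  finally have "AE x in noise. (\<Sum>m. ennreal (v m x)) \<noteq> \<infinity>"
    by (intro nn_integral_PInf_AE) auto
  then show ?thesis
  proof eventually_elim
    case (elim x)
    then have "summable (\<lambda>m. v m x)" using v by (intro summable_suminf_not_top) auto
    then show ?case by (simp add: v_def l_def)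
  qed
qed

lemma AE_cookie_env_zero_speed:
  assumes "1 / 2 \<le> p" "p \<le> 1"
  shows "AE x in noise. \<forall>P. erw_law (cookie_env p x) 0 P \<longrightarrow>
    (AE Y in P. (\<lambda>n. real_of_int (Y n) / real n) \<longlonglongrightarrow> 0)"
proof -
  \<comment> \<open>With \<open>B = 2^n\<close> and \<open>q = 3^-n / 6\<close> this is the condition \<open>8 * k < q * B\<^sup>2\<close>.\<close>
  have "\<exists>n. 48 * real k < (4 / 3) ^ n" for k by (rule real_arch_pow) simp
  then obtain n where n: "\<And>k. 48 * real k < (4 / 3) ^ n k" by metis
  have "AE x in noise. \<forall>k. summable (\<lambda>m. (1 + 1 / (real (2 ^ n (Suc k)))\<^sup>2) ^ m *
    (\<Prod>j<m div (2 * 2 ^ n (Suc k) * Suc k). if good_block x (n (Suc k)) j then 1 / 2 else 1 :: real))"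
    unfolding AE_all_countable by (intro allI AE_summable_good_block n) simp
  then show ?thesis
  proof eventually_elim
    case (elim x)
    show ?case
    proof (intro allI impI)
      fix P assume P: "erw_law (cookie_env p x) 0 P"
      show "AE Y in P. (\<lambda>n. real_of_int (Y n) / real n) \<longlonglongrightarrow> 0"
      proof (rule erw_zero_speed[OF P])
        show "1 / 2 \<le> cookie_env p x (z, i) \<and> cookie_env p x (z, i) \<le> 1" if "i \<ge> 1" for z i
          using assms that by (simp add: cookie_env_def)
        fix k :: nat assume "k > 0"
        then obtain k' where k': "k = Suc k'" by (cases k) auto
        define B :: nat where "B = 2 ^ n k"
        have "\<exists>a. int (2 * B * j) \<le> a \<and> a < int (2 * B * j + B) \<and> fires x (n k) a" if "good_block x (n k) j" for j
        proof -
          obtain i where "i < 2 ^ n k" "fires x (n k) (int (2 * 2 ^ n k * j + i))"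
            using \<open>good_block x (n k) j\<close> by (auto simp: good_block_def)
          then show ?thesis by (intro exI[of _ "int (2 * B * j + i)"]) (auto simp: B_def)
        qed
        then obtain a where a: "\<And>j. good_block x (n k) j \<Longrightarrow>
            int (2 * B * j) \<le> a j \<and> a j < int (2 * B * j + B) \<and> fires x (n k) (a j)" by metis
        have gap: "cookie_env p x (z, i) = 1 / 2"
          if "good_block x (n k) j" "a j < z" "z < a j + int B" "i \<ge> 1" for j z i
        proof -
          have "nat (z - a j) < 2 ^ n k" "fires x (n k) (z - int (nat (z - a j)))"
            using that a[OF that(1)] by (auto simp: B_def nat_less_iff)
          then have "covered x z" unfolding covered_def by blast
          then show ?thesis using that by (simp add: cookie_env_def)
        qed
        have sum: "summable (\<lambda>m. (1 + 1 / (real B)\<^sup>2) ^ m *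
            (\<Prod>j<m div (2 * B * k). if good_block x (n k) j then 1 / 2 else 1 :: real))"
          using elim[rule_format, of k'] by (simp only: B_def k')
        show "\<exists>B G a. B > 0 \<and>
          (\<forall>j. G j \<longrightarrow> int (2 * B * j) \<le> a j \<and> a j < int (2 * B * j + B) \<and>
            (\<forall>z i. a j < z \<longrightarrow> z < a j + int B \<longrightarrow> i \<ge> 1 \<longrightarrow> cookie_env p x (z, i) = 1 / 2)) \<and>
          summable (\<lambda>m. (1 + 1 / (real B)\<^sup>2) ^ m * (\<Prod>j<m div (2 * B * k). if G j then 1 / 2 else 1 :: real))"
          using a gap sum by (intro exI[of _ B] exI[of _ "good_block x (n k)"] exI[of _ a]) (auto simp: B_def)
      qed
    qed
  qed
qed

theorem mainTheorem1:
  fixes p :: real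
  assumes "1 / 2 < p" and "p < 1"
  shows "\<exists>(Q :: env measure) (W :: env \<Rightarrow> env) (M :: int \<Rightarrow> env \<Rightarrow> enat).
           random_cookie_env p Q W M \<and>
           ergodic_law (distr Q env_space W) \<and>
           (\<forall>z. (\<integral>\<^sup>+ x. ennreal_of_enat (M z x) \<partial>Q) = \<infinity>) \<and>
           (AE x in Q. \<forall>P. erw_law (W x) 0 P \<longrightarrow>
              (AE Y in P. (\<lambda>n. real_of_int (Y n) / real n) \<longlonglongrightarrow> 0))"
proof (rule exI[of _ noise], rule exI[of _ "cookie_env p"], rule exI[of _ cookie_number], intro conjI)
  show "random_cookie_env p noise (cookie_env p) cookie_number"
    using assms by (intro random_cookie_env_noise) auto
  show "ergodic_law (distr noise env_space (cookie_env p))"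
    using assms by (intro ergodic_cookie_env) auto
  show "\<forall>z. (\<integral>\<^sup>+ x. ennreal_of_enat (cookie_number z x) \<partial>noise) = \<infinity>"
    by (intro allI cookie_number_infinite)
  show "AE x in noise. \<forall>P. erw_law (cookie_env p x) 0 P \<longrightarrow>
      (AE Y in P. (\<lambda>n. real_of_int (Y n) / real n) \<longlonglongrightarrow> 0)"
    using assms by (intro AE_cookie_env_zero_speed) auto
qed

end
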